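(* Let $M$ be a dichotomic surface and let $\mathcal F$ be an oriented foliation of $M$. Then no leaf of $\mathcal F$ is dense in $M$. Moreover, no finite union of leaves of $\mathcal F$ is dense in $M$.
   Context: A surface is a connected Hausdorff topological $2$-manifold without boundary, NOT assumed metrizable or second countable. A surface $M$ is dichotomic if every Jordan curve (embedded circle) $J\subset M$ divides it, i.e. $M\setminus J$ is disconnected. A foliation of a surface is a $C^0$ one-dimensional foliation (locally modelled on the partition of $\mathbb R^2$ into parallel lines); it is oriented if its leaves are given orientations which are locally coherent in foliated charts. *)

theory Defs
  imports "HOL-Analysis.Analysis"
begin

section \<open>Surfaces\<close>

definition plane_chart :: "'a topology \<Rightarrow> 'a set \<Rightarrow> ('a \<Rightarrow> real \<times> real) \<Rightarrow> bool" where
  "plane_chart M U \<phi> \<longleftrightarrow> openin M U \<and> homeomorphic_map (subtopology M U) euclidean \<phi>"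

text \<open>The library counts the empty space as connected, so nonemptiness is stated separately.\<close>

definition surface :: "'a topology \<Rightarrow> bool" where
  "surface M \<longleftrightarrow>
     topspace M \<noteq> {} \<and> connected_space M \<and> Hausdorff_space M \<and>
     (\<forall>p\<in>topspace M. \<exists>U \<phi>. p \<in> U \<and> plane_chart M U \<phi>)"

definition jordan_curve_in :: "'a topology \<Rightarrow> 'a set \<Rightarrow> bool" where
  "jordan_curve_in M J \<longleftrightarrow>
     J \<subseteq> topspace M \<and> top_of_set (sphere (0::complex) 1) homeomorphic_space subtopology M J"

definition dichotomic :: "'a topology \<Rightarrow> bool" where
  "dichotomic M \<longleftrightarrow> (\<forall>J. jordan_curve_in M J \<longrightarrow> \<not> connectedin M (topspace M - J))"


section \<open>Foliations\<close>

type_synonym 'a atlas2 = "('a set \<times> ('a \<Rightarrow> real \<times> real)) set"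
type_synonym 'a atlas1 = "('a set \<times> ('a \<Rightarrow> real)) set"

text \<open>
  A foliation is given by a foliated atlas: charts onto the plane, foliated by its
  horizontal lines, whose coordinate changes are locally of the form
  \<open>(x, y) \<mapsto> (f (x, y), g y)\<close>. Continuity and local injectivity of \<open>g\<close> are automatic, since
  coordinate changes are homeomorphisms and the condition holds for both orders of two charts.
  The atlas need not be maximal; compatible atlases have the same leaves and leaf topology.
\<close>

definition foliation :: "'a topology \<Rightarrow> 'a atlas2 \<Rightarrow> bool" where
  "foliation M \<A> \<longleftrightarrow>
     (\<forall>(U, \<phi>)\<in>\<A>. plane_chart M U \<phi>) \<and>
     (\<Union>(U, \<phi>)\<in>\<A>. U) = topspace M \<and>
     (\<forall>(U, \<phi>)\<in>\<A>. \<forall>(V, \<psi>)\<in>\<A>. \<forall>p\<in>U \<inter> V.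
        \<exists>W g. openin M W \<and> p \<in> W \<and> W \<subseteq> U \<inter> V \<and> (\<forall>q\<in>W. snd (\<psi> q) = g (snd (\<phi> q))))"

definition plaques :: "'a atlas2 \<Rightarrow> 'a set set" where
  "plaques \<A> = {{q \<in> U. snd (\<phi> q) = c} | U \<phi> c. (U, \<phi>) \<in> \<A>}"

definition leaf_topology :: "'a topology \<Rightarrow> 'a atlas2 \<Rightarrow> 'a topology" where
  "leaf_topology M \<A> = topology_generated_by {P \<inter> W | P W. P \<in> plaques \<A> \<and> openin M W}"

definition leaves :: "'a topology \<Rightarrow> 'a atlas2 \<Rightarrow> 'a set set" where
  "leaves M \<A> = path_components_of (leaf_topology M \<A>)"


section \<open>Orientations\<close>

text \<open>The germ of \<open>k\<close> at \<open>p\<close> is a strictly increasing function of the germ of \<open>h\<close>.\<close>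

definition same_direction_at ::
    "'a topology \<Rightarrow> ('a \<Rightarrow> real) \<Rightarrow> ('a \<Rightarrow> real) \<Rightarrow> 'a \<Rightarrow> bool" where
  "same_direction_at T h k p \<longleftrightarrow>
     (\<exists>W. openin T W \<and> p \<in> W \<and> (\<forall>x\<in>W. \<forall>y\<in>W. h x < h y \<longrightarrow> k x < k y))"

text \<open>
  An orientation of a one-dimensional topological manifold, given by an atlas of charts
  onto open subsets of the line with locally increasing coordinate changes.
\<close>

definition orientation_1 :: "'a topology \<Rightarrow> 'a atlas1 \<Rightarrow> bool" where
  "orientation_1 T \<O> \<longleftrightarrow>
     (\<forall>(I, h)\<in>\<O>. openin T I \<and> open (h ` I) \<and>
        homeomorphic_map (subtopology T I) (top_of_set (h ` I)) h) \<and>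
     (\<Union>(I, h)\<in>\<O>. I) = topspace T \<and>
     (\<forall>(I, h)\<in>\<O>. \<forall>(J, k)\<in>\<O>. \<forall>p\<in>I \<inter> J. same_direction_at T h k p)"

text \<open>
  \<open>s\<close> (either \<open>1\<close> or \<open>-1\<close>) compares the orientation \<open>Or L\<close> of the leaf \<open>L\<close> through \<open>q\<close>
  with the horizontal direction of the chart \<open>\<phi>\<close>.
\<close>

definition direction_in_chart_at ::
    "'a topology \<Rightarrow> 'a atlas2 \<Rightarrow> ('a set \<Rightarrow> 'a atlas1) \<Rightarrow> ('a \<Rightarrow> real \<times> real) \<Rightarrow> real \<Rightarrow> 'a \<Rightarrow> bool"
  where
  "direction_in_chart_at M \<A> Or \<phi> s q \<longleftrightarrow>
     (\<forall>L\<in>leaves M \<A>. \<forall>(I, h)\<in>Or L. q \<in> I \<longrightarrow>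
        same_direction_at (subtopology (leaf_topology M \<A>) L) h (\<lambda>x. s * fst (\<phi> x)) q)"

definition oriented_foliation ::
    "'a topology \<Rightarrow> 'a atlas2 \<Rightarrow> ('a set \<Rightarrow> 'a atlas1) \<Rightarrow> bool" where
  "oriented_foliation M \<A> Or \<longleftrightarrow>
     foliation M \<A> \<and>
     (\<forall>L\<in>leaves M \<A>. orientation_1 (subtopology (leaf_topology M \<A>) L) (Or L)) \<and>
     (\<forall>(U, \<phi>)\<in>\<A>. \<forall>p\<in>U. \<exists>V. openin M V \<and> p \<in> V \<and> V \<subseteq> U \<and>
        (\<exists>s\<in>{1, -1}. \<forall>q\<in>V. direction_in_chart_at M \<A> Or \<phi> s q))"


section \<open>Density\<close>

definition dense_subset :: "'a topology \<Rightarrow> 'a set \<Rightarrow> bool" where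
  "dense_subset M S \<longleftrightarrow> M closure_of S = topspace M"

end

theory Submission
  imports Defs
begin

text \<open>
  If a leaf accumulates at a transversal segment, then two of its points on the segment are joined
  by an arc of the leaf which does not meet the segment in between. This arc and the piece of the
  segment between its ends form a Jordan curve. The curve is two-sided and separates the surface,
  so the two sides of the segment lie in different parts of the complement. Since the leaf crosses
  the segment always in the same direction, its continuation after the arc, and likewise before
  it, can never come back to the piece of the segment. Hence the leaf misses a whole interval of
  the transversal. Thus leaves are nowhere dense, and so are their finite unions.
\<close>

section \<open>Jordan curves in a topological space\<close>

text \<open>Since \<open>M\<close> need not be metrizable, a leaf may be a long line: it need not
  have a parametrisation by the reals, and sequences do not describe closures. Motion along leaves
  is therefore carried by compact injective arcs, and two points of a leaf are compared by asking
  whether such an arc leads from one to the other; on a circle leaf both directions are possible.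
  First returns exist by compactness of parameter intervals. The hypothesis on \<open>M\<close> says
  only that the complement of a Jordan curve is disconnected, not which of its pieces touch the
  curve. That both parts accumulate at every point of the curve is derived from a local
  two-sidedness, checked also at the two corners, together with connectedness of the curve and of
  \<open>M\<close>. The orientation fixes the shape of the corners: the arc leaves the segment to
  the right and comes back to it from the left, so a continuation starts on one side of the segment
  and can return only from the other. What concerns the past of an arc, or a transversal run
  downwards, follows by reversing a coordinate of the charts.\<close>

lemma jordan_curve_in_loop:
  fixes h :: "real \<Rightarrow> 'a" and a b :: real
  assumes M: "Hausdorff_space M" and h: "continuous_map (top_of_set {a..b}) M h"
    and ab: "a < b" and eq: "h a = h b" and inj: "inj_on h {a..<b}"
  shows "jordan_curve_in M (h ` {a..b})"
proof -
  \<comment> \<open>\<open>p\<close> wraps the interval once around the circle. It identifies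
    exactly the points that \<open>h\<close> identifies, so \<open>h\<close> descends to an
    injective continuous map from a compact space to a Hausdorff space, which is an
    embedding.\<close>
  define p where "p = (\<lambda>t. cis (2 * pi * ((t - a) / (b - a))))"
  have cp: "continuous_map (top_of_set {a..b}) (top_of_set (sphere 0 1)) p"
    unfolding p_def using ab by (auto intro!: continuous_intros)
  have per: "p a = p b"
    using ab by (simp add: p_def)
  have surj: "p ` {a..b} = sphere 0 1"
  proof
    show "p ` {a..b} \<subseteq> sphere 0 1"
      by (auto simp: p_def)
    show "sphere 0 1 \<subseteq> p ` {a..b}"
    proof
      fix z :: complex assume "z \<in> sphere 0 1"
      then have z: "z = cis (Arg2pi z)"
        using Arg2pi_eq[of z] by (simp add: cis_conv_exp)
      define t where "t = a + (b - a) * (Arg2pi z / (2 * pi))"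
      have "0 \<le> Arg2pi z / (2 * pi)" "Arg2pi z / (2 * pi) \<le> 1"
        using Arg2pi_ge_0[of z] Arg2pi_lt_2pi[of z] by auto
      moreover from this have "(b - a) * (Arg2pi z / (2 * pi)) \<le> (b - a) * 1"
        using ab by (intro mult_left_mono) auto
      moreover have "0 \<le> (b - a) * (Arg2pi z / (2 * pi))"
        using ab Arg2pi_ge_0[of z] by simp
      ultimately have "t \<in> {a..b}"
        by (auto simp: t_def)
      moreover have "p t = z"
        using ab z by (simp add: p_def t_def)
      ultimately show "z \<in> p ` {a..b}" by blast
    qed
  qed
  have p_inj: "s = t" if "s \<in> {a..<b}" "t \<in> {a..<b}" "p s = p t" for s t
  proof -
    have r: "0 \<le> (s - a) / (b - a)" "(s - a) / (b - a) < 1" "0 \<le> (t - a) / (b - a)" "(t - a) / (b - a) < 1"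
      using that ab by auto
    define S T where "S = 2 * pi * ((s - a) / (b - a))" and "T = 2 * pi * ((t - a) / (b - a))"
    have "exp (\<i> * of_real S) = exp (\<i> * of_real T)"
      using that by (simp add: p_def S_def T_def cis_conv_exp)
    then obtain n :: int where "\<i> * of_real S = \<i> * of_real T + of_int (2 * n) * pi * \<i>"
      by (auto simp: exp_eq)
    then have "\<i> * complex_of_real S = \<i> * of_real (T + 2 * n * pi)"
      by (simp add: algebra_simps)
    then have "S = T + 2 * n * pi"
      by (simp only: mult_cancel_left complex_i_not_zero of_real_eq_iff) simp
    then have "2 * pi * ((s - a) / (b - a)) = 2 * pi * ((t - a) / (b - a) + n)"
      by (simp add: S_def T_def algebra_simps)
    then have e: "(s - a) / (b - a) = (t - a) / (b - a) + n"
      by (subst (asm) mult_cancel_left) auto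
    then have "real_of_int n < 1" "-1 < real_of_int n"
      using r by linarith+
    then have "n = 0" by linarith
    then show "s = t" using e ab by simp
  qed
  have p_eq: "h s = h t \<longleftrightarrow> p s = p t" if "s \<in> {a..b}" "t \<in> {a..b}" for s t
  proof -
    define s' t' where "s' = (if s = b then a else s)" and "t' = (if t = b then a else t)"
    have "s' \<in> {a..<b}" "t' \<in> {a..<b}" "h s' = h s" "h t' = h t" "p s' = p s" "p t' = p t"
      using that ab eq per by (auto simp: s'_def t'_def)
    then show ?thesis
      using p_inj inj by (metis inj_onD)
  qed
  have q: "quotient_map (top_of_set {a..b}) (top_of_set (sphere 0 1)) p"
    by (rule continuous_imp_quotient_map[OF cp])
      (simp_all add: surj compact_space_subtopology Hausdorff_space_subtopology)
  define f where "f z = h (SOME t. t \<in> {a..b} \<and> p t = z)" for z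
  have fp: "f (p t) = h t" if "t \<in> {a..b}" for t
  proof -
    have "(SOME s. s \<in> {a..b} \<and> p s = p t) \<in> {a..b} \<and> p (SOME s. s \<in> {a..b} \<and> p s = p t) = p t"
      by (rule someI[where x = t]) (use that in simp)
    then show ?thesis
      unfolding f_def using p_eq that by blast
  qed
  have "continuous_map (top_of_set {a..b}) M (f \<circ> p)"
    by (rule continuous_map_eq[OF h]) (simp add: fp)
  then have "continuous_map (top_of_set (sphere 0 1)) M f"
    using q by (rule continuous_compose_quotient_map[rotated])
  moreover have im: "f ` sphere 0 1 = h ` {a..b}"
    unfolding surj[symmetric] image_image using fp by auto
  moreover have "inj_on f (sphere 0 1)"
    unfolding surj[symmetric] by (auto simp: inj_on_def fp p_eq)
  moreover have sub: "h ` {a..b} \<subseteq> topspace M"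
    using h by (simp add: continuous_map_def Pi_iff image_subset_iff)
  ultimately have "homeomorphic_map (top_of_set (sphere 0 1)) (subtopology M (h ` {a..b})) f"
    by (intro continuous_imp_homeomorphic_map)
      (auto simp: continuous_map_in_subtopology compact_space_subtopology Hausdorff_space_subtopology M)
  then show ?thesis
    using sub unfolding jordan_curve_in_def
    using homeomorphic_map_imp_homeomorphic_space by blast
qed

text \<open>The ends of \<open>f\<close> are left out of \<open>meet\<close> because they are the
  ends of \<open>g\<close>. Running through \<open>g\<close> and then \<open>f\<close> gives a loop
  that is injective up to its last parameter.\<close>

lemma jordan_curve_in_two_arcs:
  fixes g f :: "real \<Rightarrow> 'a"
  assumes M: "Hausdorff_space M"
    and g: "continuous_map (top_of_set {u..v}) M g" "inj_on g {u..v}" "u < v"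
    and f: "continuous_map (top_of_set {a..b}) M f" "inj_on f {a..b}" "a < b"
    and ends: "g v = f a" "f b = g u"
    and meet: "\<And>s t. s \<in> {u..v} \<Longrightarrow> t \<in> {a<..<b} \<Longrightarrow> g s \<noteq> f t"
  shows "jordan_curve_in M (g ` {u..v} \<union> f ` {a..b})"
proof -
  define w where "w = v + (b - a)"
  define h where "h = (\<lambda>\<tau>. if \<tau> \<le> v then g \<tau> else f (a + (\<tau> - v)))"
  have "continuous_map (top_of_set {u..w}) M h"
    unfolding h_def
  proof (rule continuous_map_cases_le)
    have "{x \<in> {u..w}. x \<le> v} = {u..v}"
      using f(3) by (auto simp: w_def)
    then show "continuous_map (subtopology (top_of_set {u..w}) {x \<in> topspace (top_of_set {u..w}). x \<le> v}) M g"
      using g(1) f(3) by (simp add: subtopology_subtopology Int_absorb1 w_def min_def)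
    have e: "{u..w} \<inter> {x. u \<le> x \<and> x \<le> w \<and> v \<le> x} = {v..w}"
      using g(3) by (auto simp: w_def)
    have "continuous_map (top_of_set {v..w}) (top_of_set {a..b}) (\<lambda>\<tau>. a + (\<tau> - v))"
      by (auto intro!: continuous_intros simp: w_def)
    from continuous_map_compose[OF this f(1)]
    show "continuous_map (subtopology (top_of_set {u..w}) {x \<in> topspace (top_of_set {u..w}). v \<le> x}) M
        (\<lambda>\<tau>. f (a + (\<tau> - v)))"
      by (simp add: subtopology_subtopology o_def e)
  qed (use ends in auto)
  moreover have "inj_on h {u..<w}"
  proof (rule linorder_inj_onI)
    fix s t assume st: "s < t" "s \<in> {u..<w}" "t \<in> {u..<w}"
    consider "t \<le> v" | "s \<le> v" "v < t" | "v < s" by linarith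
    then show "h s \<noteq> h t"
    proof cases
      case 1 then show ?thesis using st inj_onD[OF g(2), of s t] by (auto simp: h_def)
    next
      case 2
      then have "g s \<noteq> f (a + (t - v))"
        using st by (intro meet) (auto simp: w_def)
      then show ?thesis using 2 by (simp add: h_def)
    next
      case 3
      have "a + (s - v) \<in> {a..b}" "a + (t - v) \<in> {a..b}" "a + (s - v) \<noteq> a + (t - v)"
        using 3 st by (auto simp: w_def)
      with f(2) show ?thesis using 3 st unfolding h_def inj_on_def by fastforce
    qed
  qed auto
  moreover have "h u = h w"
    using g(3) f(3) ends by (simp add: h_def w_def)
  moreover have "u < w" using g(3) f(3) by (simp add: w_def)
  moreover have "h ` {u..w} = g ` {u..v} \<union> f ` {a..b}"
  proof (intro equalityI subsetI)
    fix q assume "q \<in> h ` {u..w}"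
    then obtain \<tau> where t: "\<tau> \<in> {u..w}" "q = h \<tau>" by blast
    show "q \<in> g ` {u..v} \<union> f ` {a..b}"
    proof (cases "\<tau> \<le> v")
      case True then show ?thesis using t by (auto simp: h_def)
    next
      case False
      then have "a + (\<tau> - v) \<in> {a..b}" using t by (auto simp: w_def)
      then show ?thesis using t False by (auto simp: h_def)
    qed
  next
    fix q assume "q \<in> g ` {u..v} \<union> f ` {a..b}"
    then consider \<tau> where "\<tau> \<in> {u..v}" "q = g \<tau>" | \<tau> where "\<tau> \<in> {a..b}" "q = f \<tau>" by blast
    then show "q \<in> h ` {u..w}"
    proof cases
      case (1 \<tau>) then show ?thesis
        using f(3) by (intro image_eqI[where x = \<tau>]) (auto simp: h_def w_def)
    next
      case (2 \<tau>) then show ?thesis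
        using g(3) ends by (intro image_eqI[where x = "v + (\<tau> - a)"]) (auto simp: h_def w_def)
    qed
  qed
  ultimately show ?thesis
    using jordan_curve_in_loop[OF M, of u w h] by simp
qed

text \<open>The local condition makes the closure of \<open>A\<close> meet \<open>J\<close> in a relatively clopen set.\<close>

lemma separated_part_accumulates:
  assumes conn: "connected_space M" and J: "closedin M J" "connectedin M J"
    and loc: "\<And>p. p \<in> J \<Longrightarrow> \<exists>D D1 D2. openin M D \<and> p \<in> D \<and> D - J = D1 \<union> D2 \<and>
        connectedin M D1 \<and> connectedin M D2 \<and> J \<inter> D \<subseteq> M closure_of D1 \<and> J \<inter> D \<subseteq> M closure_of D2"
    and A: "openin M A" "A \<noteq> {}" and B: "openin M B" "B \<noteq> {}"
    and AB: "A \<inter> B = {}" "A \<union> B = topspace M - J"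
  shows "J \<subseteq> M closure_of A"
proof -
  have J_top: "J \<subseteq> topspace M"
    using J(1) by (simp add: closedin_subset)
  have D: "\<exists>W. openin M W \<and> p \<in> W \<and> J \<inter> W \<subseteq> M closure_of A" if p: "p \<in> J" "p \<in> M closure_of A" for p
  proof -
    obtain D D1 D2 where D: "openin M D" "p \<in> D" "D - J = D1 \<union> D2" "connectedin M D1"
      "connectedin M D2" "J \<inter> D \<subseteq> M closure_of D1" "J \<inter> D \<subseteq> M closure_of D2"
      using loc[OF p(1)] by blast
    \<comment> \<open>The local side of \<open>J\<close> that contains a point of \<open>A\<close>
      is connected and misses \<open>J\<close>, so it lies wholly in \<open>A\<close>; its closure
      contains all of \<open>J\<close> near \<open>p\<close>.\<close>
    obtain q where q: "q \<in> A" "q \<in> D"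
      using p(2) D(1,2) by (auto simp: in_closure_of)
    then have "q \<in> D1 \<union> D2" using D(3) AB by auto
    then obtain D' where D': "D' = D1 \<or> D' = D2" "q \<in> D'" by blast
    have c: "connectedin M D'" "J \<inter> D \<subseteq> M closure_of D'" "D' \<subseteq> D - J"
      using D D' by auto
    have "D' \<subseteq> A \<union> B"
      using c(3) AB(2) openin_subset[OF D(1)] by blast
    then have "D' \<subseteq> A"
      using connectedinD[OF c(1) A(1) B(1)] AB(1) q D'(2) by blast
    then show ?thesis
      using D(1,2) c(2) closure_of_mono[of D' A M] by (intro exI[of _ D]) auto
  qed
  have "closedin M (M closure_of A \<inter> J)"
    using J(1) by (simp add: closedin_Int)
  moreover have "openin (subtopology M J) (M closure_of A \<inter> J)"
  proof (subst openin_subopen, clarify)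
    fix p assume "p \<in> M closure_of A" "p \<in> J"
    then obtain W where "openin M W" "p \<in> W" "J \<inter> W \<subseteq> M closure_of A"
      using D by blast
    then show "\<exists>T. openin (subtopology M J) T \<and> p \<in> T \<and> T \<subseteq> M closure_of A \<inter> J"
      using \<open>p \<in> J\<close> by (intro exI[where x = "J \<inter> W"]) (auto simp: openin_subtopology_Int2)
  qed
  moreover have "closedin (subtopology M J) (M closure_of A \<inter> J)"
    using J(1) by (meson closedin_closure_of closedin_subtopology)
  moreover have "connected_space (subtopology M J)"
    using J(2) by (simp add: connectedin_def)
  ultimately have "M closure_of A \<inter> J = {} \<or> M closure_of A \<inter> J = J"
    unfolding connected_space_clopen_in using J_top
    by (auto simp: Int_absorb1)
  \<comment> \<open>Otherwise \<open>A\<close> would be its own closure and would split the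
    connected space \<open>M\<close>.\<close>
  moreover have "M closure_of A \<inter> J \<noteq> {}"
  proof
    assume e: "M closure_of A \<inter> J = {}"
    have "M closure_of A \<inter> B = {}"
      using AB(1) B(1) by (metis Int_commute openin_Int_closure_of_eq_empty)
    moreover have "M closure_of A \<subseteq> topspace M"
      by (rule closure_of_subset_topspace)
    ultimately have "M closure_of A \<subseteq> A" using e AB(2) by blast
    then have "closedin M A"
      using closure_of_subset_eq openin_subset[OF A(1)] by blast
    then have "A = {} \<or> A = topspace M"
      using A(1) conn unfolding connected_space_clopen_in by blast
    then show False
      using A(2) B AB openin_subset[OF B(1)] by blast
  qed
  ultimately show ?thesis by blast
qed

section \<open>Positively oriented arcs in leaves\<close>

text \<open>
  The parametrisations in \<open>E\<close> are inverse charts: each maps the horizontal lines of the plane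
  to plaques, with increasing first coordinate following the orientation of the leaf.
\<close>

locale directed_atlas =
  fixes M :: "'a topology" and E :: "(real \<times> real \<Rightarrow> 'a) set"
  assumes connected: "connected_space M" and hausdorff: "Hausdorff_space M"
    and continuous: "e \<in> E \<Longrightarrow> continuous_map euclidean M e"
    and open_map: "e \<in> E \<Longrightarrow> open_map euclidean M e"
    and injective: "e \<in> E \<Longrightarrow> inj e"
    and covering: "p \<in> topspace M \<Longrightarrow> \<exists>e\<in>E. p \<in> range e"
    and flip: "e \<in> E \<Longrightarrow> (\<lambda>(x, y). e (x, - y)) \<in> E"
    and transition: "e \<in> E \<Longrightarrow> e' \<in> E \<Longrightarrow> e (x, y) = e' (x', y') \<Longrightarrow>
      \<exists>\<delta>>0. \<exists>\<xi>. continuous_on (ball x' \<delta>) \<xi> \<and> strict_mono_on (ball x' \<delta>) \<xi> \<and>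
        (\<forall>s\<in>ball x' \<delta>. e' (s, y') = e (\<xi> s, y))"

text \<open>The charts are asked for locally, so an arc may pass through many of them; continuity
  follows. Injectivity makes arcs usable in Jordan curves and keeps an arc in a circle leaf from
  closing up. The case \<open>u = v\<close> is allowed and gives the trivial arc at a point.\<close>

definition positive_arc :: "(real \<times> real \<Rightarrow> 'a) set \<Rightarrow> (real \<Rightarrow> 'a) \<Rightarrow> real \<Rightarrow> real \<Rightarrow> bool" where
  "positive_arc E g u v \<longleftrightarrow> u \<le> v \<and> inj_on g {u..v} \<and>
     (\<forall>t\<in>{u..v}. \<exists>e\<in>E. \<exists>y \<xi>. \<exists>\<delta>>0.
        continuous_on ({u..v} \<inter> ball t \<delta>) \<xi> \<and> strict_mono_on ({u..v} \<inter> ball t \<delta>) \<xi> \<and>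
        (\<forall>\<tau>\<in>{u..v} \<inter> ball t \<delta>. g \<tau> = e (\<xi> \<tau>, y)))"

definition reach :: "(real \<times> real \<Rightarrow> 'a) set \<Rightarrow> 'a \<Rightarrow> 'a \<Rightarrow> bool" where
  "reach E p q \<longleftrightarrow> (\<exists>g u v. positive_arc E g u v \<and> g u = p \<and> g v = q)"

definition saturated :: "(real \<times> real \<Rightarrow> 'a) set \<Rightarrow> 'a set \<Rightarrow> bool" where
  "saturated E S \<longleftrightarrow> (\<forall>e\<in>E. \<forall>x x' y. e (x, y) \<in> S \<longrightarrow> e (x', y) \<in> S)"

text \<open>Together with \<open>saturated\<close> this describes leaves without a topology: the
  nonempty sets with both properties are the minimal nonempty saturated sets. The geometric part
  sees leaves only in this way.\<close>

definition indecomposable :: "(real \<times> real \<Rightarrow> 'a) set \<Rightarrow> 'a set \<Rightarrow> bool" where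
  "indecomposable E L \<longleftrightarrow> (\<forall>S. saturated E S \<and> S \<inter> L \<noteq> {} \<longrightarrow> L \<subseteq> S)"

text \<open>This reverses the orientation of all leaves, so that a statement about what follows an
  arc yields one about what precedes it.\<close>

definition mirror :: "(real \<times> real \<Rightarrow> 'a) set \<Rightarrow> (real \<times> real \<Rightarrow> 'a) set" where
  "mirror E = (\<lambda>e (x, y). e (- x, y)) ` E"

section \<open>Positive arcs and reversal of the orientation\<close>

lemma positive_arc_imp_le: "positive_arc E g u v \<Longrightarrow> u \<le> v"
  by (simp add: positive_arc_def)

lemma positive_arc_imp_inj: "positive_arc E g u v \<Longrightarrow> inj_on g {u..v}"
  by (simp add: positive_arc_def)

lemma positive_arc_subinterval:
  assumes "positive_arc E g u v" "u \<le> u'" "u' \<le> v'" "v' \<le> v"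
  shows "positive_arc E g u' v'"
  unfolding positive_arc_def
proof (intro conjI ballI)
  show "inj_on g {u'..v'}"
    using positive_arc_imp_inj[OF assms(1)] by (rule inj_on_subset) (use assms in auto)
  fix t assume t: "t \<in> {u'..v'}"
  then have "t \<in> {u..v}" using assms by auto
  then obtain e y \<xi> \<delta> where *: "e \<in> E" "\<delta> > 0" "continuous_on ({u..v} \<inter> ball t \<delta>) \<xi>"
      "strict_mono_on ({u..v} \<inter> ball t \<delta>) \<xi>" "\<forall>\<tau>\<in>{u..v} \<inter> ball t \<delta>. g \<tau> = e (\<xi> \<tau>, y)"
    using assms(1) unfolding positive_arc_def by blast
  have sub: "{u'..v'} \<inter> ball t \<delta> \<subseteq> {u..v} \<inter> ball t \<delta>"
    using assms by auto
  show "\<exists>e\<in>E. \<exists>y \<xi>. \<exists>\<delta>>0. continuous_on ({u'..v'} \<inter> ball t \<delta>) \<xi> \<and>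
      strict_mono_on ({u'..v'} \<inter> ball t \<delta>) \<xi> \<and> (\<forall>\<tau>\<in>{u'..v'} \<inter> ball t \<delta>. g \<tau> = e (\<xi> \<tau>, y))"
    using * sub continuous_on_subset[OF *(3) sub] monotone_on_subset[OF *(4) sub] by blast
qed (use assms in auto)

lemma mirror_mirror: "mirror (mirror E) = E"
proof -
  have "(\<lambda>(x, y). (\<lambda>(x, y). e (- x, y)) (- x, y)) = e" for e :: "real \<times> real \<Rightarrow> 'a"
    by auto
  then show ?thesis
    unfolding mirror_def by (auto simp: image_image image_def)
qed

text \<open>Reversing the parameter and the first coordinate together keeps the local coordinate
  functions increasing.\<close>

lemma positive_arc_mirror:
  assumes "positive_arc E g u v"
  shows "positive_arc (mirror E) (\<lambda>t. g (- t)) (- v) (- u)"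
  unfolding positive_arc_def
proof (intro conjI ballI)
  show "- v \<le> - u" using positive_arc_imp_le[OF assms] by simp
  show "inj_on (\<lambda>t. g (- t)) {- v..- u}"
  proof (rule inj_onI)
    fix s t assume "s \<in> {- v..- u}" "t \<in> {- v..- u}" "g (- s) = g (- t)"
    then show "s = t"
      using inj_onD[OF positive_arc_imp_inj[OF assms], of "- s" "- t"] by auto
  qed
  fix t assume "t \<in> {- v..- u}"
  then have "- t \<in> {u..v}" by auto
  then obtain e y \<xi> \<delta> where *: "e \<in> E" "\<delta> > 0" "continuous_on ({u..v} \<inter> ball (- t) \<delta>) \<xi>"
      "strict_mono_on ({u..v} \<inter> ball (- t) \<delta>) \<xi>" "\<forall>\<tau>\<in>{u..v} \<inter> ball (- t) \<delta>. g \<tau> = e (\<xi> \<tau>, y)"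
    using assms unfolding positive_arc_def by blast
  have sub: "- s \<in> {u..v} \<inter> ball (- t) \<delta>" if "s \<in> {- v..- u} \<inter> ball t \<delta>" for s
    using that by (auto simp: dist_real_def)
  have "continuous_on ({- v..- u} \<inter> ball t \<delta>) (\<lambda>s. - \<xi> (- s))"
    by (intro continuous_on_minus continuous_on_compose2[OF *(3)] continuous_on_id)
      (use sub in blast)
  moreover have "strict_mono_on ({- v..- u} \<inter> ball t \<delta>) (\<lambda>s. - \<xi> (- s))"
    using *(4) sub unfolding strict_mono_on_def by (metis neg_less_iff_less)
  moreover have "(\<lambda>(x, y). e (- x, y)) \<in> mirror E"
    using *(1) by (auto simp: mirror_def)
  moreover have "g (- s) = (\<lambda>(x, y). e (- x, y)) (- \<xi> (- s), y)" if "s \<in> {- v..- u} \<inter> ball t \<delta>" for s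
    using *(5) sub[OF that] by auto
  ultimately show "\<exists>e\<in>mirror E. \<exists>y \<xi>. \<exists>\<delta>>0. continuous_on ({- v..- u} \<inter> ball t \<delta>) \<xi> \<and>
      strict_mono_on ({- v..- u} \<inter> ball t \<delta>) \<xi> \<and> (\<forall>\<tau>\<in>{- v..- u} \<inter> ball t \<delta>. g (- \<tau>) = e (\<xi> \<tau>, y))"
    using *(2) by blast
qed

lemma reach_mirror: "reach (mirror E) p q \<longleftrightarrow> reach E q p"
proof -
  have "reach (mirror E) p q" if "reach E q p" for E :: "(real \<times> real \<Rightarrow> 'a) set" and p q
    using that positive_arc_mirror unfolding reach_def by (metis add.inverse_inverse)
  from this[of E] this[of "mirror E"] show ?thesis by (auto simp: mirror_mirror)
qed

context directed_atlas
begin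

lemma directed_atlas_mirror: "directed_atlas M (mirror E)"
proof
  fix e assume "e \<in> mirror E"
  then obtain e0 where e0: "e0 \<in> E" "e = (\<lambda>(x, y). e0 (- x, y))"
    by (auto simp: mirror_def)
  define r :: "real \<times> real \<Rightarrow> real \<times> real" where "r = (\<lambda>(x, y). (- x, y))"
  have er: "e = e0 \<circ> r" by (auto simp: e0 r_def)
  have rr: "r \<circ> r = id" by (auto simp: r_def)
  have r: "continuous_on UNIV r"
    unfolding r_def case_prod_unfold by (intro continuous_intros)
  show "continuous_map euclidean M e"
    unfolding er by (intro continuous_map_compose[of _ euclidean] continuous[OF e0(1)]) (use r in auto)
  have "open (r ` U)" if "open U" for U
  proof -
    have "r ` U = r -` U"
      using rr by (auto simp: fun_eq_iff image_iff) (metis)+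
    then show ?thesis
      using that r by (simp add: continuous_on_open_vimage)
  qed
  then show "open_map euclidean M e"
    unfolding er by (intro open_map_compose[of _ euclidean] open_map[OF e0(1)]) (auto simp: open_map_def)
  show "inj e"
    unfolding er by (intro inj_compose injective[OF e0(1)]) (auto simp: r_def inj_def)
  show "(\<lambda>(x, y). e (x, - y)) \<in> mirror E"
    unfolding mirror_def by (rule image_eqI[OF _ flip[OF e0(1)]]) (auto simp: e0(2))
  fix e' x y x' y' assume "e' \<in> mirror E" and eq: "e (x, y) = e' (x', y')"
  then obtain e1 where e1: "e1 \<in> E" "e' = (\<lambda>(x, y). e1 (- x, y))"
    by (auto simp: mirror_def)
  obtain \<delta> \<xi> where *: "\<delta> > 0" "continuous_on (ball (- x') \<delta>) \<xi>" "strict_mono_on (ball (- x') \<delta>) \<xi>"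
      "\<forall>s\<in>ball (- x') \<delta>. e1 (s, y') = e0 (\<xi> s, y)"
    using transition[OF e0(1) e1(1), of "- x" y "- x'" y'] eq e0(2) e1(2) by auto
  have sub: "- s \<in> ball (- x') \<delta>" if "s \<in> ball x' \<delta>" for s
    using that by (auto simp: dist_real_def)
  have "continuous_on (ball x' \<delta>) (\<lambda>s. - \<xi> (- s))"
    by (intro continuous_on_minus continuous_on_compose2[OF *(2)] continuous_on_id)
      (use sub in blast)
  moreover have "strict_mono_on (ball x' \<delta>) (\<lambda>s. - \<xi> (- s))"
    using *(3) sub unfolding strict_mono_on_def by (metis neg_less_iff_less)
  moreover have "\<forall>s\<in>ball x' \<delta>. e' (s, y') = e (- \<xi> (- s), y)"
    using *(4) sub e0(2) e1(2) by auto
  ultimately show "\<exists>\<delta>>0. \<exists>\<xi>. continuous_on (ball x' \<delta>) \<xi> \<and> strict_mono_on (ball x' \<delta>) \<xi> \<and>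
        (\<forall>s\<in>ball x' \<delta>. e' (s, y') = e (\<xi> s, y))"
    using *(1) by blast
next
  fix p assume "p \<in> topspace M"
  then obtain e x y where "e \<in> E" "p = e (x, y)"
    using covering by (metis imageE surj_pair)
  then have "p = (\<lambda>(x, y). e (- x, y)) (- x, y)" "(\<lambda>(x, y). e (- x, y)) \<in> mirror E"
    by (auto simp: mirror_def)
  then show "\<exists>e\<in>mirror E. p \<in> range e" by blast
qed (fact connected hausdorff)+

section \<open>Arcs in charts and their continuation along plaques\<close>

lemma chart_eq_iff: "e \<in> E \<Longrightarrow> e (x, y) = e (x', y') \<longleftrightarrow> x = x' \<and> y = y'"
  using injective by (auto dest: injD)

lemma chart_in_topspace: "e \<in> E \<Longrightarrow> e z \<in> topspace M"
  using continuous[of e] by (auto simp: continuous_map_def)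

lemma open_chart_image: "e \<in> E \<Longrightarrow> open U \<Longrightarrow> openin M (e ` U)"
  using open_map by (simp add: open_map_def)

lemma closed_chart_vimage: "e \<in> E \<Longrightarrow> closedin M C \<Longrightarrow> closed (e -` C)"
  using closedin_continuous_map_preimage[OF continuous, of e C] by (simp add: vimage_def)

text \<open>The definition provides just some chart at \<open>t\<close>. Composing its coordinate
  function with a transition map gives the same local form in any prescribed chart through
  \<open>g t\<close>.\<close>

lemma positive_arc_in_chart:
  assumes g: "positive_arc E g u v" and t: "t \<in> {u..v}" and e: "e \<in> E" and gt: "g t = e (x, y)"
  obtains \<delta> \<xi> where "\<delta> > 0" "continuous_on ({u..v} \<inter> ball t \<delta>) \<xi>"
    "strict_mono_on ({u..v} \<inter> ball t \<delta>) \<xi>" "\<And>\<tau>. \<tau> \<in> {u..v} \<inter> ball t \<delta> \<Longrightarrow> g \<tau> = e (\<xi> \<tau>, y)" "\<xi> t = x"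
proof -
  obtain e' y' \<eta> \<epsilon> where *: "e' \<in> E" "\<epsilon> > 0" "continuous_on ({u..v} \<inter> ball t \<epsilon>) \<eta>"
      "strict_mono_on ({u..v} \<inter> ball t \<epsilon>) \<eta>" "\<forall>\<tau>\<in>{u..v} \<inter> ball t \<epsilon>. g \<tau> = e' (\<eta> \<tau>, y')"
    using g t unfolding positive_arc_def by blast
  have tt: "t \<in> {u..v} \<inter> ball t \<epsilon>" using t * by auto
  then have "e (x, y) = e' (\<eta> t, y')" using * gt by auto
  then obtain \<rho> \<zeta> where z: "\<rho> > 0" "continuous_on (ball (\<eta> t) \<rho>) \<zeta>" "strict_mono_on (ball (\<eta> t) \<rho>) \<zeta>"
      "\<forall>s\<in>ball (\<eta> t) \<rho>. e' (s, y') = e (\<zeta> s, y)"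
    using transition[OF e *(1)] by blast
  obtain d where d: "d > 0" "\<forall>\<tau>\<in>{u..v} \<inter> ball t \<epsilon>. dist \<tau> t < d \<longrightarrow> dist (\<eta> \<tau>) (\<eta> t) < \<rho>"
    using *(3) tt z(1) unfolding continuous_on_iff by blast
  define \<delta> where "\<delta> = min \<epsilon> d"
  have sub: "{u..v} \<inter> ball t \<delta> \<subseteq> {u..v} \<inter> ball t \<epsilon>" by (auto simp: \<delta>_def)
  have im: "\<eta> \<tau> \<in> ball (\<eta> t) \<rho>" if "\<tau> \<in> {u..v} \<inter> ball t \<delta>" for \<tau>
    using that d sub by (auto simp: \<delta>_def dist_commute)
  show thesis
  proof (rule that[of \<delta> "\<zeta> \<circ> \<eta>"])
    show "\<delta> > 0" using * d by (simp add: \<delta>_def)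
    show "continuous_on ({u..v} \<inter> ball t \<delta>) (\<zeta> \<circ> \<eta>)"
      using continuous_on_subset[OF *(3) sub] continuous_on_subset[OF z(2)] im
      by (intro continuous_on_compose) (auto simp: image_subset_iff)
    show "strict_mono_on ({u..v} \<inter> ball t \<delta>) (\<zeta> \<circ> \<eta>)"
      using monotone_on_subset[OF *(4) sub] z(3) im unfolding strict_mono_on_def o_def by blast
    show gg: "g \<tau> = e ((\<zeta> \<circ> \<eta>) \<tau>, y)" if "\<tau> \<in> {u..v} \<inter> ball t \<delta>" for \<tau>
      using *(5) z(4) im[OF that] that sub by auto
    have "e ((\<zeta> \<circ> \<eta>) t, y) = e (x, y)"
      using gg[of t] gt tt \<open>\<delta> > 0\<close> by auto
    then show "(\<zeta> \<circ> \<eta>) t = x" using e chart_eq_iff by blast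
  qed
qed

lemma positive_arc_continuous:
  assumes g: "positive_arc E g u v"
  shows "continuous_map (top_of_set {u..v}) M g"
  unfolding continuous_map_def
proof (intro conjI allI impI)
  have loc: "\<exists>e\<in>E. \<exists>y \<xi>. \<exists>\<delta>>0. continuous_on ({u..v} \<inter> ball t \<delta>) \<xi> \<and>
      (\<forall>\<tau>\<in>{u..v} \<inter> ball t \<delta>. g \<tau> = e (\<xi> \<tau>, y))" if "t \<in> {u..v}" for t
    using g that unfolding positive_arc_def by blast
  show "g \<in> topspace (top_of_set {u..v}) \<rightarrow> topspace M"
  proof
    fix t assume "t \<in> topspace (top_of_set {u..v})"
    then have t: "t \<in> {u..v}" by simp
    then obtain e y \<xi> \<delta> where "e \<in> E" "\<delta> > 0" "\<forall>\<tau>\<in>{u..v} \<inter> ball t \<delta>. g \<tau> = e (\<xi> \<tau>, y)"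
      using loc by blast
    with t have "g t = e (\<xi> t, y)" by auto
    with \<open>e \<in> E\<close> show "g t \<in> topspace M" by (simp add: chart_in_topspace)
  qed
  fix U assume U: "openin M U"
  show "openin (top_of_set {u..v}) {x \<in> topspace (top_of_set {u..v}). g x \<in> U}"
    unfolding openin_euclidean_subtopology_iff
  proof (intro conjI ballI)
    fix t assume "t \<in> {x \<in> topspace (top_of_set {u..v}). g x \<in> U}"
    then have t: "t \<in> {u..v}" "g t \<in> U" by auto
    then obtain e y \<xi> \<delta> where *: "e \<in> E" "\<delta> > 0" "continuous_on ({u..v} \<inter> ball t \<delta>) \<xi>"
        "\<forall>\<tau>\<in>{u..v} \<inter> ball t \<delta>. g \<tau> = e (\<xi> \<tau>, y)"
      using loc by blast
    have "open (e -` U)"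
      using openin_continuous_map_preimage[OF continuous[OF *(1)] U] by (simp add: vimage_def)
    moreover have "(\<xi> t, y) \<in> e -` U" using t * by auto
    ultimately obtain r where r: "r > 0" "ball (\<xi> t, y) r \<subseteq> e -` U"
      by (meson open_contains_ball)
    obtain d where d: "d > 0" "\<forall>\<tau>\<in>{u..v} \<inter> ball t \<delta>. dist \<tau> t < d \<longrightarrow> dist (\<xi> \<tau>) (\<xi> t) < r"
      using *(2,3) t r(1) unfolding continuous_on_iff by (metis Int_iff centre_in_ball)
    have "g \<tau> \<in> U" if "\<tau> \<in> {u..v}" "dist \<tau> t < min d \<delta>" for \<tau>
    proof -
      have \<tau>: "\<tau> \<in> {u..v} \<inter> ball t \<delta>" using that by (auto simp: dist_commute)
      then have "dist (\<xi> \<tau>) (\<xi> t) < r" using d that by auto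
      then have "(\<xi> \<tau>, y) \<in> ball (\<xi> t, y) r" by (simp add: dist_Pair_Pair dist_commute)
      then show ?thesis using r *(4) \<tau> by auto
    qed
    then show "\<exists>e>0. \<forall>x'\<in>{u..v}. dist x' t < e \<longrightarrow> x' \<in> {x \<in> topspace (top_of_set {u..v}). g x \<in> U}"
      using d(1) *(2) by (intro exI[of _ "min d \<delta>"]) auto
  qed auto
qed

lemma closedin_positive_arc_image:
  assumes g: "positive_arc E g u v" and K: "compact K" "K \<subseteq> {u..v}"
  shows "closedin M (g ` K)"
proof -
  have "compactin (top_of_set {u..v}) K"
    using K by (simp add: compactin_subtopology)
  then show ?thesis
    using image_compactin positive_arc_continuous[OF g] hausdorff compactin_imp_closedin by blast
qed

lemma positive_arc_plaque:
  assumes e: "e \<in> E" and x: "x \<le> x'"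
  shows "positive_arc E (\<lambda>x. e (x, y)) x x'"
  unfolding positive_arc_def
proof (intro conjI ballI x)
  show "inj_on (\<lambda>x. e (x, y)) {x..x'}" using e by (auto simp: inj_on_def chart_eq_iff)
  fix t
  show "\<exists>e'\<in>E. \<exists>y' \<xi>. \<exists>\<delta>>0. continuous_on ({x..x'} \<inter> ball t \<delta>) \<xi> \<and>
      strict_mono_on ({x..x'} \<inter> ball t \<delta>) \<xi> \<and> (\<forall>\<tau>\<in>{x..x'} \<inter> ball t \<delta>. e (\<tau>, y) = e' (\<xi> \<tau>, y'))"
    by (intro bexI[OF _ e] exI[of _ y] exI[of _ "\<lambda>x. x"] exI[of _ "1::real"])
      (auto simp: strict_mono_on_def)
qed

lemma positive_arc_extend:
  assumes g: "positive_arc E g u v" and e: "e \<in> E" and gv: "g v = e (x, y)" and x: "x \<le> x'"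
    and off: "\<And>s. x < s \<Longrightarrow> s \<le> x' \<Longrightarrow> e (s, y) \<notin> g ` {u..v}"
  shows "positive_arc E (\<lambda>\<tau>. if \<tau> \<le> v then g \<tau> else e (x + (\<tau> - v), y)) u (v + (x' - x))"
    (is "positive_arc E ?h u ?w")
  unfolding positive_arc_def
proof (intro conjI ballI)
  have uv: "u \<le> v" using g by (rule positive_arc_imp_le)
  show "u \<le> ?w" using uv x by simp
  show "inj_on ?h {u..?w}"
  proof (rule linorder_inj_onI)
    fix s t assume st: "s < t" "s \<in> {u..?w}" "t \<in> {u..?w}"
    consider "t \<le> v" | "s \<le> v" "v < t" | "v < s" by linarith
    then show "?h s \<noteq> ?h t"
    proof cases
      case 1 then show ?thesis
        using st inj_onD[OF positive_arc_imp_inj[OF g], of s t] by auto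
    next
      case 2
      then have "e (x + (t - v), y) \<notin> g ` {u..v}"
        using st by (intro off) auto
      moreover have "g s \<in> g ` {u..v}" using 2 st by auto
      ultimately show ?thesis using 2 by auto
    next
      case 3 then show ?thesis using st by (auto simp: chart_eq_iff[OF e])
    qed
  qed auto
  fix t assume t: "t \<in> {u..?w}"
  consider "t < v" | "t = v" | "v < t" by linarith
  then show "\<exists>e\<in>E. \<exists>y \<xi>. \<exists>\<delta>>0. continuous_on ({u..?w} \<inter> ball t \<delta>) \<xi> \<and>
      strict_mono_on ({u..?w} \<inter> ball t \<delta>) \<xi> \<and> (\<forall>\<tau>\<in>{u..?w} \<inter> ball t \<delta>. ?h \<tau> = e (\<xi> \<tau>, y))"
  proof cases
    case 1
    then have "t \<in> {u..v}" using t by auto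
    then obtain e' y' \<xi> \<delta> where *: "e' \<in> E" "\<delta> > 0" "continuous_on ({u..v} \<inter> ball t \<delta>) \<xi>"
        "strict_mono_on ({u..v} \<inter> ball t \<delta>) \<xi>" "\<forall>\<tau>\<in>{u..v} \<inter> ball t \<delta>. g \<tau> = e' (\<xi> \<tau>, y')"
      using g unfolding positive_arc_def by blast
    have sub: "{u..?w} \<inter> ball t (min \<delta> (v - t)) \<subseteq> {u..v} \<inter> ball t \<delta>"
      by (auto simp: dist_real_def)
    show ?thesis
      using *(1,2,5) 1 sub continuous_on_subset[OF *(3) sub] monotone_on_subset[OF *(4) sub]
      by (intro bexI[OF _ *(1)] exI[of _ y'] exI[of _ \<xi>] exI[of _ "min \<delta> (v - t)"])
        (auto simp: subset_iff)
  next
    case 2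
    \<comment> \<open>At the junction the coordinate of \<open>g\<close> is taken in the chart
      \<open>e\<close> itself, so that it is continued beyond \<open>v\<close> by a translation of
      the parameter.\<close>
    have "t \<in> {u..v}" using t 2 uv by auto
    then obtain \<delta> \<xi> where *: "\<delta> > 0" "continuous_on ({u..v} \<inter> ball t \<delta>) \<xi>"
        "strict_mono_on ({u..v} \<inter> ball t \<delta>) \<xi>" "\<And>\<tau>. \<tau> \<in> {u..v} \<inter> ball t \<delta> \<Longrightarrow> g \<tau> = e (\<xi> \<tau>, y)" "\<xi> t = x"
      using positive_arc_in_chart[OF g _ e] gv 2 by metis
    define \<eta> where "\<eta> = (\<lambda>\<tau>. if \<tau> \<le> v then \<xi> \<tau> else x + (\<tau> - v))"
    have vv: "v \<in> {u..v} \<inter> ball t \<delta>" using 2 * uv by auto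
    have "continuous_on ({u..?w} \<inter> ball t \<delta>) \<eta>"
      unfolding \<eta>_def
    proof (rule continuous_on_cases_le)
      show "continuous_on {s \<in> {u..?w} \<inter> ball t \<delta>. s \<le> v} \<xi>"
        by (rule continuous_on_subset[OF *(2)]) auto
    qed (use 2 *(5) in \<open>auto intro!: continuous_intros\<close>)
    moreover have "strict_mono_on ({u..?w} \<inter> ball t \<delta>) \<eta>"
    proof (rule strict_mono_onI)
      fix r s assume rs: "r \<in> {u..?w} \<inter> ball t \<delta>" "s \<in> {u..?w} \<inter> ball t \<delta>" "r < s"
      consider "s \<le> v" | "r \<le> v" "v < s" | "v < r" by linarith
      then show "\<eta> r < \<eta> s"
      proof cases
        case 1 then show ?thesis
          using rs strict_mono_onD[OF *(3), of r s] by (auto simp: \<eta>_def)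
      next
        case b: 2
        then have "\<xi> r \<le> \<xi> v"
          using rs vv strict_mono_onD[OF *(3), of r v] by (cases "r = v") auto
        then show ?thesis using b 2 *(5) by (auto simp: \<eta>_def)
      next
        case 3 then show ?thesis using rs by (auto simp: \<eta>_def)
      qed
    qed
    moreover have "\<forall>\<tau>\<in>{u..?w} \<inter> ball t \<delta>. ?h \<tau> = e (\<eta> \<tau>, y)"
      using *(4) by (auto simp: \<eta>_def)
    ultimately show ?thesis using e *(1) by blast
  next
    case 3
    have "\<forall>\<tau>\<in>{u..?w} \<inter> ball t (t - v). ?h \<tau> = e (x + (\<tau> - v), y)"
      by (auto simp: dist_real_def)
    moreover have "continuous_on ({u..?w} \<inter> ball t (t - v)) (\<lambda>\<tau>. x + (\<tau> - v))"
      by (intro continuous_intros)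
    moreover have "strict_mono_on ({u..?w} \<inter> ball t (t - v)) (\<lambda>\<tau>. x + (\<tau> - v))"
      by (auto simp: strict_mono_on_def)
    ultimately show ?thesis using e 3 by (metis diff_gt_0_iff_gt)
  qed
qed

text \<open>On a circle leaf the added piece of plaque may run into the arc again, which would
  destroy injectivity. The arc is therefore cut at the last point of this piece that lies on it, and
  continued from there.\<close>

lemma reach_extend:
  assumes r: "reach E p (e (x, y))" and e: "e \<in> E" and x: "x \<le> x'"
  shows "reach E p (e (x', y))"
proof -
  obtain g u v where g: "positive_arc E g u v" "g u = p" "g v = e (x, y)"
    using r by (auto simp: reach_def)
  have uv: "u \<le> v" using g(1) by (rule positive_arc_imp_le)
  define X where "X = {x..x'} \<inter> (\<lambda>s. (s, y)) -` (e -` (g ` {u..v}))"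
  have "closed (e -` (g ` {u..v}))"
    by (intro closed_chart_vimage e closedin_positive_arc_image[OF g(1)]) auto
  then have "closed ((\<lambda>s. (s, y)) -` (e -` (g ` {u..v})))"
    by (intro continuous_closed_vimage) (auto intro!: continuous_intros)
  then have "compact X"
    unfolding X_def by (intro compact_Int_closed) auto
  moreover have "x \<in> X"
    using x uv g(3)[symmetric] by (auto simp: X_def)
  ultimately obtain m where m: "m \<in> X" "\<And>s. s \<in> X \<Longrightarrow> s \<le> m"
    using compact_attains_sup[of X] by blast
  then obtain t where t: "t \<in> {u..v}" "g t = e (m, y)" "x \<le> m" "m \<le> x'"
    by (auto simp: X_def)
  have "e (s, y) \<notin> g ` {u..t}" if "m < s" "s \<le> x'" for s
  proof
    assume "e (s, y) \<in> g ` {u..t}"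
    then have "s \<in> X" using that t by (auto simp: X_def)
    then show False using m(2) that by force
  qed
  then have "positive_arc E (\<lambda>\<tau>. if \<tau> \<le> t then g \<tau> else e (m + (\<tau> - t), y)) u (t + (x' - m))"
    using t by (intro positive_arc_extend positive_arc_subinterval[OF g(1)] e) auto
  then show ?thesis
    unfolding reach_def using t g(2)
    by (intro exI[of _ "\<lambda>\<tau>. if \<tau> \<le> t then g \<tau> else e (m + (\<tau> - t), y)"] exI[of _ u] exI[of _ "t + (x' - m)"]) auto
qed

lemma reach_plaque: "e \<in> E \<Longrightarrow> x \<le> x' \<Longrightarrow> reach E (e (x, y)) (e (x', y))"
  using positive_arc_plaque unfolding reach_def by blast

text \<open>Followed back from its end, an arc could leave the plaque segment only through
  \<open>e (x', y)\<close>. The proof is by connectedness: the parameters at which \<open>k\<close>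
  lies in the segment form a clopen subset of \<open>{u..v}\<close>.\<close>

lemma positive_arc_backward:
  assumes k: "positive_arc E k u v" and e: "e \<in> E" and kv: "k v = e (x, y)" and x: "x' \<le> x"
    and off: "e (x', y) \<notin> k ` {u..v}"
  shows "\<exists>z. x' < z \<and> z \<le> x \<and> k u = e (z, y)"
proof -
  have uv: "u \<le> v" using k by (rule positive_arc_imp_le)
  define T where "T = {t \<in> {u..v}. k t \<in> (\<lambda>s. e (s, y)) ` {x'..x}}"
  have "closedin M ((\<lambda>s. e (s, y)) ` {x'..x})"
    using closedin_positive_arc_image[OF positive_arc_plaque[OF e x], of "{x'..x}"] by auto
  then have "closedin (top_of_set {u..v}) T"
    unfolding T_def using closedin_continuous_map_preimage[OF positive_arc_continuous[OF k]] by auto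
  moreover have "openin (top_of_set {u..v}) T"
    unfolding openin_euclidean_subtopology_iff
  proof (intro conjI ballI)
    fix t assume "t \<in> T"
    then obtain z where z: "t \<in> {u..v}" "k t = e (z, y)" "x' \<le> z" "z \<le> x"
      by (auto simp: T_def)
    have zx': "x' < z" using z off by (metis imageI order_le_less)
    \<comment> \<open>By injectivity only the parameter \<open>v\<close> can sit at the right end
      \<open>x\<close>. Before \<open>v\<close> the arc lies to the left of it, so that near
      \<open>v\<close> only the bound at \<open>x'\<close> matters.\<close>
    have zx: "z < x" if "t \<noteq> v"
    proof -
      have "k t \<noteq> k v" using that z uv inj_onD[OF positive_arc_imp_inj[OF k], of t v] by auto
      then show ?thesis using z kv by (cases "z = x") auto
    qed
    obtain \<delta> \<xi> where *: "\<delta> > 0" "continuous_on ({u..v} \<inter> ball t \<delta>) \<xi>"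
        "strict_mono_on ({u..v} \<inter> ball t \<delta>) \<xi>" "\<And>\<tau>. \<tau> \<in> {u..v} \<inter> ball t \<delta> \<Longrightarrow> k \<tau> = e (\<xi> \<tau>, y)" "\<xi> t = z"
      using positive_arc_in_chart[OF k z(1) e z(2)] by metis
    define r where "r = (if t = v then z - x' else min (z - x') (x - z))"
    have "r > 0" using zx' zx by (auto simp: r_def)
    moreover have "t \<in> {u..v} \<inter> ball t \<delta>" using z *(1) by auto
    ultimately obtain d where d: "d > 0" "\<forall>\<tau>\<in>{u..v} \<inter> ball t \<delta>. dist \<tau> t < d \<longrightarrow> dist (\<xi> \<tau>) (\<xi> t) < r"
      using *(2) unfolding continuous_on_iff by blast
    have "\<tau> \<in> T" if \<tau>: "\<tau> \<in> {u..v}" "dist \<tau> t < min d \<delta>" for \<tau>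
    proof -
      have b: "\<tau> \<in> {u..v} \<inter> ball t \<delta>" using \<tau> by (auto simp: dist_commute)
      then have "dist (\<xi> \<tau>) z < r" using d \<tau> *(5) by auto
      moreover have "\<xi> \<tau> \<le> z" if "t = v"
        using strict_mono_onD[OF *(3) b \<open>t \<in> {u..v} \<inter> ball t \<delta>\<close>] \<tau>(1) that *(5) by (cases "\<tau> = t") auto
      ultimately have "x' \<le> \<xi> \<tau>" "\<xi> \<tau> \<le> x"
        using z by (auto simp: r_def dist_real_def split: if_splits)
      then show ?thesis using *(4)[OF b] \<tau>(1) by (auto simp: T_def)
    qed
    then show "\<exists>e>0. \<forall>x'\<in>{u..v}. dist x' t < e \<longrightarrow> x' \<in> T"
      using d(1) *(1) by (intro exI[of _ "min d \<delta>"]) auto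
  qed (auto simp: T_def)
  moreover have "v \<in> T" using uv kv x by (auto simp: T_def)
  ultimately have "T = {u..v}"
    using connected_clopen[of "{u..v}"] by auto
  then have "u \<in> T" using uv by simp
  then obtain z where "k u = e (z, y)" "x' \<le> z" "z \<le> x"
    by (auto simp: T_def)
  moreover from this have "z \<noteq> x'" using off uv by (metis atLeastAtMost_iff imageI order_refl)
  ultimately show ?thesis by (metis order_le_less)
qed

lemma positive_arc_forward:
  assumes k: "positive_arc E k u v" and e: "e \<in> E" and ku: "k u = e (x, y)" and x: "x \<le> x'"
    and off: "e (x', y) \<notin> k ` {u..v}"
  shows "\<exists>z. x \<le> z \<and> z < x' \<and> k v = e (z, y)"
proof -
  interpret m: directed_atlas M "mirror E" by (rule directed_atlas_mirror)
  have "(\<lambda>(x, y). e (- x, y)) \<in> mirror E" using e by (auto simp: mirror_def)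
  moreover have "(\<lambda>t. k (- t)) ` {- v..- u} = k ` {u..v}"
    by (simp add: image_image[symmetric, of k uminus])
  ultimately obtain z where "- x' < z" "z \<le> - x" "k v = e (- z, y)"
    using m.positive_arc_backward[OF positive_arc_mirror[OF k], of "\<lambda>(x, y). e (- x, y)" "- x" y "- x'"]
      ku x off by auto
  then show ?thesis by (intro exI[of _ "- z"]) auto
qed

section \<open>The orbit of an arc is saturated\<close>

definition orbit :: "(real \<Rightarrow> 'a) \<Rightarrow> real \<Rightarrow> real \<Rightarrow> 'a set" where
  "orbit g u v = g ` {u..v} \<union> {c. reach E (g v) c} \<union> {c. reach E c (g u)}"

text \<open>\<open>orbit\<close> plays the role of the leaf through \<open>g\<close>: the points on
  the arc, after it and before it. When moving forward in a plaque, either the target still lies on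
  the arc at hand, or that arc ends within the plaque segment and the rest of the segment continues
  it.\<close>

lemma orbit_forward:
  assumes g: "positive_arc E g u v" and e: "e \<in> E" and x: "x \<le> x'" and c: "e (x, y) \<in> orbit g u v"
  shows "e (x', y) \<in> orbit g u v"
proof -
  have A: "e (x', y) \<in> orbit g u v" if "g t = e (z, y)" "t \<in> {u..v}" "z \<le> x'" for t z
  proof (cases "e (x', y) \<in> g ` {t..v}")
    case True then show ?thesis using that by (auto simp: orbit_def)
  next
    case False
    have "positive_arc E g t v" by (rule positive_arc_subinterval[OF g]) (use that in auto)
    from positive_arc_forward[OF this e that(1,3) False]
    show ?thesis using reach_plaque[OF e] by (auto simp: orbit_def)
  qed
  consider t where "t \<in> {u..v}" "g t = e (x, y)" | "reach E (g v) (e (x, y))" | "reach E (e (x, y)) (g u)"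
    using c by (auto simp: orbit_def)
  then show ?thesis
  proof cases
    case 1 then show ?thesis using A x by blast
  next
    case 2 then show ?thesis using reach_extend[OF _ e x] by (auto simp: orbit_def)
  next
    case 3
    then obtain k a b where k: "positive_arc E k a b" "k a = e (x, y)" "k b = g u"
      by (auto simp: reach_def)
    show ?thesis
    proof (cases "e (x', y) \<in> k ` {a..b}")
      case True
      then obtain s where s: "s \<in> {a..b}" "e (x', y) = k s" by blast
      then have "positive_arc E k s b" by (intro positive_arc_subinterval[OF k(1)]) auto
      then show ?thesis using s k by (auto simp: orbit_def reach_def)
    next
      case False
      from positive_arc_forward[OF k(1) e k(2) x False] show ?thesis
        using A[of u] k(3) positive_arc_imp_le[OF g] by auto
    qed
  qed
qed

lemma saturated_orbit:
  assumes g: "positive_arc E g u v"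
  shows "saturated E (orbit g u v)"
  unfolding saturated_def
proof (intro ballI allI impI)
  fix e x x' y assume e: "e \<in> E" and c: "e (x, y) \<in> orbit g u v"
  interpret m: directed_atlas M "mirror E" by (rule directed_atlas_mirror)
  have "(\<lambda>t. g (- t)) ` {- v..- u} = g ` {u..v}"
    by (simp add: image_image[symmetric, of g uminus])
  \<comment> \<open>The mirror image exchanges the points reached from \<open>g v\<close> with those
    from which \<open>g u\<close> is reached, so the orbit stays the same.\<close>
  then have o: "m.orbit (\<lambda>t. g (- t)) (- v) (- u) = orbit g u v"
    by (auto simp: m.orbit_def orbit_def reach_mirror)
  have e': "(\<lambda>(x, y). e (- x, y)) \<in> mirror E" using e by (auto simp: mirror_def)
  show "e (x', y) \<in> orbit g u v"
  proof (cases "x \<le> x'")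
    case True then show ?thesis using orbit_forward[OF g e _ c] by blast
  next
    case False then show ?thesis
      using m.orbit_forward[OF positive_arc_mirror[OF g] e', of "- x" "- x'" y] c o by auto
  qed
qed

lemma indecomposable_subset_orbit:
  assumes "positive_arc E g u v" "indecomposable E L" "g u \<in> L"
  shows "L \<subseteq> orbit g u v"
proof -
  have "g u \<in> orbit g u v" using positive_arc_imp_le[OF assms(1)] by (auto simp: orbit_def)
  then show ?thesis
    using assms saturated_orbit unfolding indecomposable_def by blast
qed

section \<open>The trace of an arc near one of its points\<close>

lemma open_chart_square:
  assumes e: "e \<in> E" and C: "closedin M C" and p: "e (x0, y0) \<notin> C"
  obtains \<epsilon> where "\<epsilon> > 0" "\<And>x y. \<bar>x - x0\<bar> < \<epsilon> \<Longrightarrow> \<bar>y - y0\<bar> < \<epsilon> \<Longrightarrow> e (x, y) \<notin> C"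
proof -
  have "open (- (e -` C))" using closed_chart_vimage[OF e C] by (simp add: open_closed)
  moreover have "(x0, y0) \<in> - (e -` C)" using p by auto
  ultimately obtain A B where AB: "open A" "open B" "x0 \<in> A" "y0 \<in> B" "A \<times> B \<subseteq> - (e -` C)"
    by (metis open_prod_elim mem_Sigma_iff)
  then obtain a b where ab: "a > 0" "ball x0 a \<subseteq> A" "b > 0" "ball y0 b \<subseteq> B"
    by (meson open_contains_ball)
  show thesis
  proof (rule that[of "min a b"])
    fix x y assume "\<bar>x - x0\<bar> < min a b" "\<bar>y - y0\<bar> < min a b"
    then have "x \<in> ball x0 a" "y \<in> ball y0 b" by (auto simp: dist_real_def)
    then show "e (x, y) \<notin> C" using AB ab by blast
  qed (use ab in auto)
qed

text \<open>The part of the arc outside a short parameter interval around \<open>t\<close> is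
  compact and misses \<open>g t\<close>, so it stays out of a small square. The short piece fills
  its plaque near \<open>g t\<close> by the intermediate value theorem. The two implications record
  that at an end of the arc only one half of the plaque is covered.\<close>

lemma positive_arc_trace:
  assumes g: "positive_arc E g u v" and t: "t \<in> {u..v}" and e: "e \<in> E" and gt: "g t = e (x0, y0)"
  obtains \<epsilon> where "\<epsilon> > 0" "\<And>x y. \<bar>x - x0\<bar> < \<epsilon> \<Longrightarrow> \<bar>y - y0\<bar> < \<epsilon> \<Longrightarrow>
    e (x, y) \<in> g ` {u..v} \<longleftrightarrow> y = y0 \<and> (t = u \<longrightarrow> x0 \<le> x) \<and> (t = v \<longrightarrow> x \<le> x0)"
proof -
  obtain \<delta> \<xi> where *: "\<delta> > 0" "continuous_on ({u..v} \<inter> ball t \<delta>) \<xi>"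
      "strict_mono_on ({u..v} \<inter> ball t \<delta>) \<xi>" "\<And>\<tau>. \<tau> \<in> {u..v} \<inter> ball t \<delta> \<Longrightarrow> g \<tau> = e (\<xi> \<tau>, y0)" "\<xi> t = x0"
    using positive_arc_in_chart[OF g t e gt] by metis
  have tt: "t \<in> {u..v} \<inter> ball t \<delta>" using t * by auto
  have "e (x0, y0) \<notin> g ` ({u..v} - ball t \<delta>)"
    using inj_onD[OF positive_arc_imp_inj[OF g], of t] t gt *(1) by force
  moreover have "closedin M (g ` ({u..v} - ball t \<delta>))"
    by (intro closedin_positive_arc_image[OF g]) (auto intro: compact_diff)
  ultimately obtain \<epsilon>0 where e0: "\<epsilon>0 > 0"
      "\<And>x y. \<bar>x - x0\<bar> < \<epsilon>0 \<Longrightarrow> \<bar>y - y0\<bar> < \<epsilon>0 \<Longrightarrow> e (x, y) \<notin> g ` ({u..v} - ball t \<delta>)"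
    using open_chart_square[OF e] by metis
  define a b where "a = max u (t - \<delta> / 2)" and "b = min v (t + \<delta> / 2)"
  have ab: "a \<le> t" "t \<le> b" "a \<in> {u..v} \<inter> ball t \<delta>" "b \<in> {u..v} \<inter> ball t \<delta>"
    "t \<noteq> u \<Longrightarrow> a < t" "t \<noteq> v \<Longrightarrow> t < b"
    using t *(1) by (auto simp: a_def b_def dist_real_def max_def min_def)
  have au: "t = u \<Longrightarrow> a = u" and bv: "t = v \<Longrightarrow> b = v"
    using *(1) by (auto simp: a_def b_def)
  have sub: "{a..b} \<subseteq> {u..v} \<inter> ball t \<delta>"
    using ab by (auto simp: dist_real_def)
  \<comment> \<open>At an end of the arc the bound on that side is supplied by the implication in
    the claim, so \<open>1\<close> is only a placeholder there.\<close>
  define \<epsilon> where "\<epsilon> = min \<epsilon>0 (min (if t = u then 1 else x0 - \<xi> a) (if t = v then 1 else \<xi> b - x0))"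
  show thesis
  proof (rule that)
    show "\<epsilon> > 0"
      using e0 ab strict_mono_onD[OF *(3) ab(3) tt] strict_mono_onD[OF *(3) tt ab(4)] *(5)
      by (auto simp: \<epsilon>_def)
    fix x y assume xy: "\<bar>x - x0\<bar> < \<epsilon>" "\<bar>y - y0\<bar> < \<epsilon>"
    show "e (x, y) \<in> g ` {u..v} \<longleftrightarrow> y = y0 \<and> (t = u \<longrightarrow> x0 \<le> x) \<and> (t = v \<longrightarrow> x \<le> x0)"
    proof
      assume "e (x, y) \<in> g ` {u..v}"
      then obtain \<tau> where \<tau>: "\<tau> \<in> {u..v}" "e (x, y) = g \<tau>" by blast
      have "e (x, y) \<notin> g ` ({u..v} - ball t \<delta>)" using xy by (intro e0) (auto simp: \<epsilon>_def)
      then have \<tau>': "\<tau> \<in> {u..v} \<inter> ball t \<delta>" using \<tau> by auto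
      then have "x = \<xi> \<tau>" "y = y0" using *(4) \<tau>(2) chart_eq_iff[OF e] by auto
      then show "y = y0 \<and> (t = u \<longrightarrow> x0 \<le> x) \<and> (t = v \<longrightarrow> x \<le> x0)"
        using strict_mono_onD[OF *(3) \<tau>' tt] strict_mono_onD[OF *(3) tt \<tau>'] *(5) \<tau>(1)
        by (cases "\<tau> = t") (auto simp: less_le)
    next
      assume r: "y = y0 \<and> (t = u \<longrightarrow> x0 \<le> x) \<and> (t = v \<longrightarrow> x \<le> x0)"
      have "\<xi> a \<le> x" "x \<le> \<xi> b"
        using r xy(1) *(5) by (cases "t = u"; cases "t = v"; auto simp: \<epsilon>_def au bv)+
      then obtain \<tau> where "\<tau> \<in> {a..b}" "\<xi> \<tau> = x"
        using IVT'[of \<xi> a x b] continuous_on_subset[OF *(2) sub] ab by auto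
      then show "e (x, y) \<in> g ` {u..v}"
        using *(4)[of \<tau>] sub r by (intro image_eqI[of _ _ \<tau>]) auto
    qed
  qed
qed

text \<open>Here the orientation enters: just after a point on a vertical line of a chart, every
  positive arc is to the right of the line and still in the same plaque. By
  \<open>positive_arc_arrives\<close> it comes from the left.\<close>

lemma positive_arc_leaves:
  assumes k: "positive_arc E k a b" and t: "a \<le> t" "t < b" and e: "e \<in> E" and kt: "k t = e (x, y)"
    and \<epsilon>: "\<epsilon> > 0"
  obtains r where "t < r" "r \<le> b" "\<And>\<tau>. t < \<tau> \<Longrightarrow> \<tau> \<le> r \<Longrightarrow> \<exists>x'. x < x' \<and> x' < x + \<epsilon> \<and> k \<tau> = e (x', y)"
proof -
  have t': "t \<in> {a..b}" using t by auto
  obtain \<delta> \<xi> where *: "\<delta> > 0" "continuous_on ({a..b} \<inter> ball t \<delta>) \<xi>"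
      "strict_mono_on ({a..b} \<inter> ball t \<delta>) \<xi>" "\<And>\<tau>. \<tau> \<in> {a..b} \<inter> ball t \<delta> \<Longrightarrow> k \<tau> = e (\<xi> \<tau>, y)" "\<xi> t = x"
    using positive_arc_in_chart[OF k t' e kt] by metis
  have tt: "t \<in> {a..b} \<inter> ball t \<delta>" using t *(1) by auto
  obtain d where d: "d > 0" "\<forall>\<tau>\<in>{a..b} \<inter> ball t \<delta>. dist \<tau> t < d \<longrightarrow> dist (\<xi> \<tau>) (\<xi> t) < \<epsilon>"
    using *(2) tt \<epsilon> unfolding continuous_on_iff by blast
  define r where "r = min b (t + min d \<delta> / 2)"
  show thesis
  proof (rule that[of r])
    show "t < r" "r \<le> b" using t d *(1) by (auto simp: r_def)
    fix \<tau> assume \<tau>: "t < \<tau>" "\<tau> \<le> r"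
    have "min d \<delta> > 0" using d *(1) by simp
    then have lt: "\<tau> - t < min d \<delta>" using \<tau> unfolding r_def by linarith
    then have \<tau>': "\<tau> \<in> {a..b} \<inter> ball t \<delta>" "dist \<tau> t < d"
      using \<tau> t by (auto simp: r_def dist_real_def)
    then have "dist (\<xi> \<tau>) x < \<epsilon>" using d *(5) by auto
    moreover have "x < \<xi> \<tau>" using strict_mono_onD[OF *(3) tt \<tau>'(1)] \<tau> *(5) by auto
    ultimately show "\<exists>x'. x < x' \<and> x' < x + \<epsilon> \<and> k \<tau> = e (x', y)"
      using *(4)[OF \<tau>'(1)] by (intro exI[of _ "\<xi> \<tau>"]) (auto simp: dist_real_def)
  qed
qed

lemma positive_arc_arrives:
  assumes k: "positive_arc E k a b" and t: "a < t" "t \<le> b" and e: "e \<in> E" and kt: "k t = e (x, y)"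
    and \<epsilon>: "\<epsilon> > 0"
  obtains \<tau> x' where "a < \<tau>" "\<tau> < t" "x - \<epsilon> < x'" "x' < x" "k \<tau> = e (x', y)"
proof -
  interpret m: directed_atlas M "mirror E" by (rule directed_atlas_mirror)
  have e': "(\<lambda>(x, y). e (- x, y)) \<in> mirror E" using e by (auto simp: mirror_def)
  obtain r where r: "- t < r" "r \<le> - a"
    "\<And>\<tau>. - t < \<tau> \<Longrightarrow> \<tau> \<le> r \<Longrightarrow> \<exists>x'. - x < x' \<and> x' < - x + \<epsilon> \<and> k (- \<tau>) = e (- x', y)"
    using m.positive_arc_leaves[OF positive_arc_mirror[OF k] _ _ e', of "- t" "- x" y \<epsilon>] t kt \<epsilon>
    by auto
  define \<tau> where "\<tau> = (r - t) / 2"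
  have \<tau>: "- t < \<tau>" "\<tau> < r" using r by (auto simp: \<tau>_def)
  then obtain x' where "- x < x'" "x' < - x + \<epsilon>" "k (- \<tau>) = e (- x', y)"
    using r(3)[of \<tau>] by auto
  then show thesis using that[of "- \<tau>" "- x'"] \<tau> r by auto
qed

section \<open>The curve formed by an arc and a transversal segment\<close>

lemma connectedin_chart_image: "e \<in> E \<Longrightarrow> connected C \<Longrightarrow> connectedin M (e ` C)"
  using connectedin_continuous_map_image[OF continuous] by auto

text \<open>This turns a picture drawn in the plane into the local hypothesis of
  \<open>separated_part_accumulates\<close>. The map \<open>e\<close> is open, so \<open>D\<close>
  gives a neighbourhood, and continuous, so it carries closures into closures.\<close>

lemma chart_two_sides:
  assumes e: "e \<in> E" and D: "open D" "z \<in> D" and conn: "connected D1" "connected D2"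
    and off: "\<And>z. z \<in> D \<Longrightarrow> e z \<notin> J \<longleftrightarrow> z \<in> D1 \<union> D2" and sub: "D1 \<subseteq> D" "D2 \<subseteq> D"
    and cl: "\<And>z. z \<in> D \<Longrightarrow> e z \<in> J \<Longrightarrow> z \<in> closure D1 \<and> z \<in> closure D2"
  shows "\<exists>D D1 D2. openin M D \<and> e z \<in> D \<and> D - J = D1 \<union> D2 \<and>
        connectedin M D1 \<and> connectedin M D2 \<and> J \<inter> D \<subseteq> M closure_of D1 \<and> J \<inter> D \<subseteq> M closure_of D2"
proof (intro exI conjI)
  show "openin M (e ` D)" using e D by (intro open_chart_image)
  show "e ` D - J = e ` D1 \<union> e ` D2" using off sub by blast
  have "e ` closure S \<subseteq> M closure_of (e ` S)" for S
    using continuous_map_image_closure_subset[OF continuous[OF e], of S] by simp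
  then show "J \<inter> e ` D \<subseteq> M closure_of (e ` D1)" "J \<inter> e ` D \<subseteq> M closure_of (e ` D2)"
    using cl by blast+
qed (use assms in \<open>auto intro: connectedin_chart_image\<close>)

text \<open>
  The arc \<open>g\<close> together with the transversal segment from \<open>y1\<close> to \<open>y2\<close> is a Jordan curve. Near the
  corner at \<open>y2\<close> the continuation of \<open>g\<close> lies on the side of the strip to the right of the
  segment; a continuation coming back to the curve could only do so by crossing the segment
  from the left, and would thus join its two sides off the curve.
\<close>

lemma no_forward_return:
  assumes dich: "dichotomic M" and e: "e \<in> E" and g: "positive_arc E g u v"
    and gu: "g u = e (x0, y1)" and gv: "g v = e (x0, y2)" and y12: "y1 < y2"
    and off: "\<And>t y. u < t \<Longrightarrow> t < v \<Longrightarrow> y \<in> {y1..y2} \<Longrightarrow> g t \<noteq> e (x0, y)"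
    and c: "y1 < c" "c < y2" "reach E (e (x0, y2)) (e (x0, c))"
  shows False
proof -
  have inj_e: "e (a, b) = e (a', b') \<longleftrightarrow> a = a' \<and> b = b'" for a b a' b'
    using e by (rule chart_eq_iff)
  have uv: "u < v"
    using positive_arc_imp_le[OF g] gu gv y12 by (cases "u = v") (auto simp: inj_e)
  define \<sigma> where "\<sigma> = (\<lambda>y. e (x0, y)) ` {y1..y2}"
  define J where "J = g ` {u..v} \<union> \<sigma>"
  have \<sigma>_iff: "e (x, y) \<in> \<sigma> \<longleftrightarrow> x = x0 \<and> y1 \<le> y \<and> y \<le> y2" for x y
    by (auto simp: \<sigma>_def inj_e)
  have cont: "continuous_map euclidean M (\<lambda>y. e (x0, y))"
  proof -
    have "continuous_on UNIV (\<lambda>y. (x0, y))" by (intro continuous_intros)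
    then have "continuous_map euclidean euclidean (\<lambda>y. (x0, y))" by simp
    from continuous_map_compose[OF this continuous[OF e]] show ?thesis by (simp add: o_def)
  qed
  have \<sigma>_closed: "closedin M \<sigma>"
    unfolding \<sigma>_def using image_compactin[OF _ cont, of "{y1..y2}"] hausdorff
    by (auto intro!: compactin_imp_closedin)
  have g_meets: "y = y1 \<and> t = u \<or> y = y2 \<and> t = v" if "t \<in> {u..v}" "g t = e (x0, y)" "y \<in> {y1..y2}" for t y
  proof -
    have "t = u \<or> t = v" using off[of t y] that by force
    then show ?thesis using that gu gv by (auto simp: inj_e)
  qed
  have J_closed: "closedin M J"
    unfolding J_def using \<sigma>_closed closedin_positive_arc_image[OF g, of "{u..v}"] by auto
  have J_conn: "connectedin M J"
    unfolding J_def
  proof (rule connectedin_Un)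
    have "connectedin (top_of_set {u..v}) {u..v}"
      by (simp add: connectedin_subtopology)
    then show "connectedin M (g ` {u..v})"
      by (rule connectedin_continuous_map_image[OF positive_arc_continuous[OF g]])
    show "connectedin M \<sigma>"
      unfolding \<sigma>_def by (rule connectedin_continuous_map_image[OF cont]) auto
    have "g u \<in> g ` {u..v}" using uv by simp
    moreover have "g u \<in> \<sigma>" using y12 gu by (simp add: \<sigma>_iff)
    ultimately show "g ` {u..v} \<inter> \<sigma> \<noteq> {}" by blast
  qed
  \<comment> \<open>The segment is run downwards, from \<open>g v\<close> to \<open>g u\<close>,
    hence the sign of its parameter.\<close>
  have "jordan_curve_in M (g ` {u..v} \<union> (\<lambda>s. e (x0, - s)) ` {- y2..- y1})"
  proof (rule jordan_curve_in_two_arcs[OF hausdorff])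
    show "continuous_map (top_of_set {- y2..- y1}) M (\<lambda>s. e (x0, - s))"
      using continuous_map_compose[OF _ cont, of "top_of_set {- y2..- y1}" uminus]
      by (auto simp: o_def intro!: continuous_intros)
    show "g s \<noteq> e (x0, - t)" if "s \<in> {u..v}" "t \<in> {- y2<..<- y1}" for s t
      using g_meets[of s "- t"] that by auto
  qed (use uv y12 gu gv positive_arc_continuous[OF g] positive_arc_imp_inj[OF g] in \<open>auto simp: inj_on_def inj_e\<close>)
  moreover have "(\<lambda>s. e (x0, - s)) ` {- y2..- y1} = \<sigma>"
    unfolding \<sigma>_def by (simp add: image_image[symmetric, of "\<lambda>y. e (x0, y)" uminus])
  ultimately have "jordan_curve_in M J" by (simp add: J_def)
  then have "\<not> connectedin M (topspace M - J)"
    using dich by (simp add: dichotomic_def)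
  then obtain A A' where A: "openin M A" "openin M A'" "topspace M - J \<subseteq> A \<union> A'"
      "A \<inter> A' \<inter> (topspace M - J) = {}" "A \<inter> (topspace M - J) \<noteq> {}" "A' \<inter> (topspace M - J) \<noteq> {}"
    unfolding connectedin by blast
  define P P' where "P = A - J" and "P' = A' - J"
  have P: "openin M P" "openin M P'" "P \<noteq> {}" "P' \<noteq> {}" "P \<inter> P' = {}" "P \<union> P' = topspace M - J"
    using A J_closed openin_subset[OF A(1)] openin_subset[OF A(2)]
    by (auto simp: P_def P'_def openin_diff)

  \<comment> \<open>Near its start the arc appears as a horizontal ray to the right, near its end as
    one coming from the left.\<close>
  obtain \<epsilon>1 where \<epsilon>1: "\<epsilon>1 > 0" "\<And>x y. \<bar>x - x0\<bar> < \<epsilon>1 \<Longrightarrow> \<bar>y - y1\<bar> < \<epsilon>1 \<Longrightarrow>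
      e (x, y) \<in> g ` {u..v} \<longleftrightarrow> y = y1 \<and> x0 \<le> x"
  proof (rule positive_arc_trace[OF g _ e gu])
  qed (use uv in auto)
  obtain \<epsilon>2 where \<epsilon>2: "\<epsilon>2 > 0" "\<And>x y. \<bar>x - x0\<bar> < \<epsilon>2 \<Longrightarrow> \<bar>y - y2\<bar> < \<epsilon>2 \<Longrightarrow>
      e (x, y) \<in> g ` {u..v} \<longleftrightarrow> y = y2 \<and> x \<le> x0"
  proof (rule positive_arc_trace[OF g _ e gv])
  qed (use uv in auto)
  obtain \<epsilon>3 where \<epsilon>3: "\<epsilon>3 > 0"
      "\<And>x y. \<bar>x - x0\<bar> < \<epsilon>3 \<Longrightarrow> y1 < y \<Longrightarrow> y < y2 \<Longrightarrow> e (x, y) \<notin> g ` {u..v}"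
  proof -
    \<comment> \<open>Close to the height of a corner, the local traces already exclude all points
      strictly between \<open>y1\<close> and \<open>y2\<close>. The rest of the trace is the closed
      set \<open>K\<close>; it misses the compact segment and so keeps a distance \<open>d\<close>
      from it.\<close>
    define K where "K = e -` (g ` {u..v}) \<inter> {z. \<epsilon>1 \<le> \<bar>snd z - y1\<bar>} \<inter> {z. \<epsilon>2 \<le> \<bar>snd z - y2\<bar>}"
    have "closed K"
      unfolding K_def using closedin_positive_arc_image[OF g, of "{u..v}"]
      by (intro closed_Int closed_chart_vimage[OF e] closed_Collect_le continuous_intros) auto
    moreover have "compact ({x0} \<times> {y1..y2})" by (intro compact_Times) auto
    moreover have "({x0} \<times> {y1..y2}) \<inter> K = {}"
    proof (rule ccontr)
      assume "({x0} \<times> {y1..y2}) \<inter> K \<noteq> {}"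
      then obtain z where "z \<in> ({x0} \<times> {y1..y2}) \<inter> K" by blast
      moreover define y where "y = snd z"
      ultimately have y: "y \<in> {y1..y2}" "(x0, y) \<in> K" by auto
      then have "e (x0, y) \<in> g ` {u..v}" by (simp add: K_def)
      then obtain t where "t \<in> {u..v}" "g t = e (x0, y)" by (metis imageE)
      then have "y = y1 \<or> y = y2" using g_meets y(1) by blast
      then show False using y(2) \<epsilon>1(1) \<epsilon>2(1) by (auto simp: K_def)
    qed
    ultimately obtain d where d: "d > 0" "\<And>z w. z \<in> {x0} \<times> {y1..y2} \<Longrightarrow> w \<in> K \<Longrightarrow> d \<le> dist z w"
      using separate_compact_closed by metis
    show thesis
    proof (rule that[of "min d (min \<epsilon>1 \<epsilon>2)"])
      fix x y assume xy: "\<bar>x - x0\<bar> < min d (min \<epsilon>1 \<epsilon>2)" "y1 < y" "y < y2"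
      show "e (x, y) \<notin> g ` {u..v}"
      proof
        assume i: "e (x, y) \<in> g ` {u..v}"
        then have "\<epsilon>1 \<le> \<bar>y - y1\<bar>" "\<epsilon>2 \<le> \<bar>y - y2\<bar>"
          using \<epsilon>1(2)[of x y] \<epsilon>2(2)[of x y] xy by fastforce+
        with i have "(x, y) \<in> K" by (simp add: K_def)
        then have "d \<le> dist (x0, y) (x, y)" using d(2)[of "(x0, y)"] xy by auto
        then show False using xy by (simp add: dist_Pair_Pair dist_real_def abs_minus_commute)
      qed
    qed (use d \<epsilon>1 \<epsilon>2 in auto)
  qed
  \<comment> \<open>The bound \<open>y2 - y1\<close> keeps the square at one corner from reaching
    past the other, so that \<open>J1\<close> and \<open>J2\<close> need only mention one corner
    each.\<close>
  define \<epsilon> where "\<epsilon> = min (min \<epsilon>1 \<epsilon>2) (min \<epsilon>3 (y2 - y1))"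
  have \<epsilon>: "\<epsilon> > 0" "\<epsilon> \<le> \<epsilon>1" "\<epsilon> \<le> \<epsilon>2" "\<epsilon> \<le> \<epsilon>3" "\<epsilon> \<le> y2 - y1"
    using \<epsilon>1 \<epsilon>2 \<epsilon>3 y12 by (auto simp: \<epsilon>_def)
  have J1: "e (x, y) \<in> J \<longleftrightarrow> y = y1 \<and> x0 \<le> x \<or> x = x0 \<and> y1 \<le> y"
    if "x0 - \<epsilon> < x" "x < x0 + \<epsilon>" "y1 - \<epsilon> < y" "y < y1 + \<epsilon>" for x y
    using \<epsilon>1(2)[of x y] \<epsilon> that unfolding J_def Un_iff \<sigma>_iff abs_less_iff by linarith
  have J2: "e (x, y) \<in> J \<longleftrightarrow> y = y2 \<and> x \<le> x0 \<or> x = x0 \<and> y \<le> y2"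
    if "x0 - \<epsilon> < x" "x < x0 + \<epsilon>" "y2 - \<epsilon> < y" "y < y2 + \<epsilon>" for x y
    using \<epsilon>2(2)[of x y] \<epsilon> that unfolding J_def Un_iff \<sigma>_iff abs_less_iff by linarith
  have J3: "e (x, y) \<in> J \<longleftrightarrow> x = x0" if "x0 - \<epsilon> < x" "x < x0 + \<epsilon>" "y1 < y" "y < y2" for x y
    using \<epsilon>3(2)[of x y] \<epsilon> that unfolding J_def Un_iff \<sigma>_iff abs_less_iff by linarith

  \<comment> \<open>\<open>F\<close> and \<open>B\<close> are the strips to the right and to the
    left of the segment. At \<open>y1\<close> the curve has a ray going up and one going right, at
    \<open>y2\<close> one going down and one going left; \<open>L1\<close> and \<open>L2\<close> are
    the three-quarter sectors at these corners. So \<open>L1\<close> prolongs \<open>B\<close>, and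
    \<open>L2\<close> prolongs \<open>F\<close>.\<close>
  define F where "F = {x0<..<x0+\<epsilon>} \<times> {y1<..<y2}"
  define B where "B = {x0-\<epsilon><..<x0} \<times> {y1<..<y2}"
  define L1 where "L1 = {x0-\<epsilon><..<x0} \<times> {y1-\<epsilon><..<y1+\<epsilon>} \<union> {x0-\<epsilon><..<x0+\<epsilon>} \<times> {y1-\<epsilon><..<y1}"
  define L2 where "L2 = {x0<..<x0+\<epsilon>} \<times> {y2-\<epsilon><..<y2+\<epsilon>} \<union> {x0-\<epsilon><..<x0+\<epsilon>} \<times> {y2<..<y2+\<epsilon>}"
  have rect: "connected ({a<..<b} \<times> {c<..<d})" for a b c d :: real
    by (intro connected_Times) auto
  have "(x0 - \<epsilon>/2, y1 - \<epsilon>/2) \<in> {x0-\<epsilon><..<x0} \<times> {y1-\<epsilon><..<y1+\<epsilon>} \<inter> {x0-\<epsilon><..<x0+\<epsilon>} \<times> {y1-\<epsilon><..<y1}"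
       "(x0 + \<epsilon>/2, y2 + \<epsilon>/2) \<in> {x0<..<x0+\<epsilon>} \<times> {y2-\<epsilon><..<y2+\<epsilon>} \<inter> {x0-\<epsilon><..<x0+\<epsilon>} \<times> {y2<..<y2+\<epsilon>}"
    using \<epsilon>(1) by auto
  then have L_conn: "connected L1" "connected L2"
    unfolding L1_def L2_def by (intro connected_Un rect; blast)+
  have F_conn: "connected F" and B_conn: "connected B"
    unfolding F_def B_def by (rule rect)+
  have off_J: "e z \<notin> J" if mem: "z \<in> F \<union> B \<union> L1 \<union> L2" for z
  proof -
    obtain x y where z: "z = (x, y)" by (cases z)
    consider "(x, y) \<in> F \<union> B" | "(x, y) \<in> L1" | "(x, y) \<in> L2" using mem z by blast
    then show ?thesis
    proof cases
      case 1 then show ?thesis using J3[of x y] by (auto simp: z F_def B_def)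
    next
      case 2 then show ?thesis using J1[of x y] by (auto simp: z L1_def)
    next
      case 3 then show ?thesis using J2[of x y] by (auto simp: z L2_def)
    qed
  qed

  have cl_rect: "closure ({a<..<b} \<times> {c<..<d}) = {a..b} \<times> {c..d}" if "a < b" "c < d" for a b c d :: real
    using that by (simp add: closure_Times)
  have loc: "\<exists>D D1 D2. openin M D \<and> p \<in> D \<and> D - J = D1 \<union> D2 \<and>
        connectedin M D1 \<and> connectedin M D2 \<and> J \<inter> D \<subseteq> M closure_of D1 \<and> J \<inter> D \<subseteq> M closure_of D2"
    if p: "p \<in> J" for p
  proof -
    \<comment> \<open>Points of the curve are inner points of the arc, which need a chart of their
      own, inner points of the segment, or one of the corners, where a quarter sector faces a
      three-quarter one.\<close>
    consider t where "u < t" "t < v" "p = g t" | y where "y1 < y" "y < y2" "p = e (x0, y)"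
      | "p = e (x0, y1)" | "p = e (x0, y2)"
    proof -
      from p consider t where "t \<in> {u..v}" "p = g t" | y where "y \<in> {y1..y2}" "p = e (x0, y)"
        by (auto simp: J_def \<sigma>_def)
      then show thesis
      proof cases
        case (1 t)
        show thesis
          using 1 that(1)[of t] that(3,4) gu gv
          by (metis atLeastAtMost_iff order_le_less)
      next
        case (2 y)
        then show thesis using that(2)[of y] that(3,4) by (metis atLeastAtMost_iff order_le_less)
      qed
    qed
    then show ?thesis
    proof cases
      case (1 t)
      then have "p \<in> topspace M" using p closedin_subset[OF J_closed] by blast
      then obtain e' x' y' where e': "e' \<in> E" "p = e' (x', y')"
        using covering by (metis imageE surj_pair)
      have "p \<notin> \<sigma>"
        using g_meets[of t] 1 by (force simp: \<sigma>_def)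
      then obtain r where r: "r > 0" "\<And>x y. \<bar>x - x'\<bar> < r \<Longrightarrow> \<bar>y - y'\<bar> < r \<Longrightarrow> e' (x, y) \<notin> \<sigma>"
        using open_chart_square[OF e'(1) \<sigma>_closed] e'(2) by metis
      have "t \<in> {u..v}" "g t = e' (x', y')" using 1 e' by auto
      then obtain s where s: "s > 0" "\<And>x y. \<bar>x - x'\<bar> < s \<Longrightarrow> \<bar>y - y'\<bar> < s \<Longrightarrow> e' (x, y) \<in> g ` {u..v} \<longleftrightarrow> y = y'"
        using positive_arc_trace[OF g _ e'(1)] 1 by (metis less_irrefl)
      define q where "q = min r s"
      have q: "q > 0" "\<And>x y. \<bar>x - x'\<bar> < q \<Longrightarrow> \<bar>y - y'\<bar> < q \<Longrightarrow> e' (x, y) \<in> J \<longleftrightarrow> y = y'"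
        using r s by (auto simp: q_def J_def)
      have q': "e' (x, y) \<in> J \<longleftrightarrow> y = y'" if "x' - q < x" "x < x' + q" "y' - q < y" "y < y' + q" for x y
        using that by (intro q(2)) auto
      show ?thesis
        unfolding e'(2)
      proof (rule chart_two_sides[OF e'(1)])
        show "open ({x'-q<..<x'+q} \<times> {y'-q<..<y'+q})" by (intro open_Times) auto
        show "connected ({x'-q<..<x'+q} \<times> {y'-q<..<y'})" "connected ({x'-q<..<x'+q} \<times> {y'<..<y'+q})"
          by (rule rect)+
        show "e' z \<notin> J \<longleftrightarrow> z \<in> {x'-q<..<x'+q} \<times> {y'-q<..<y'} \<union> {x'-q<..<x'+q} \<times> {y'<..<y'+q}"
          if "z \<in> {x'-q<..<x'+q} \<times> {y'-q<..<y'+q}" for z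
          using that q'[of "fst z" "snd z"] by (cases z) auto
        show "z \<in> closure ({x'-q<..<x'+q} \<times> {y'-q<..<y'}) \<and> z \<in> closure ({x'-q<..<x'+q} \<times> {y'<..<y'+q})"
          if "z \<in> {x'-q<..<x'+q} \<times> {y'-q<..<y'+q}" "e' z \<in> J" for z
          using that q'[of "fst z" "snd z"] q(1) by (cases z) (auto simp: cl_rect)
      qed (use q(1) in auto)
    next
      case (2 y)
      show ?thesis
        unfolding 2(3)
      proof (rule chart_two_sides[OF e _ _ F_conn B_conn])
        show "open ({x0-\<epsilon><..<x0+\<epsilon>} \<times> {y1<..<y2})" by (intro open_Times) auto
        show "e z \<notin> J \<longleftrightarrow> z \<in> F \<union> B" if "z \<in> {x0-\<epsilon><..<x0+\<epsilon>} \<times> {y1<..<y2}" for z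
          using that J3[of "fst z" "snd z"] by (cases z) (auto simp: F_def B_def)
        show "z \<in> closure F \<and> z \<in> closure B" if "z \<in> {x0-\<epsilon><..<x0+\<epsilon>} \<times> {y1<..<y2}" "e z \<in> J" for z
          using that J3[of "fst z" "snd z"] \<epsilon>(1) y12
          by (cases z) (auto simp: F_def B_def cl_rect)
      qed (use \<epsilon>(1) 2 in \<open>auto simp: F_def B_def\<close>)
    next
      case 3
      have cl: "closure L1 = {x0-\<epsilon>..x0} \<times> {y1-\<epsilon>..y1+\<epsilon>} \<union> {x0-\<epsilon>..x0+\<epsilon>} \<times> {y1-\<epsilon>..y1}"
        unfolding L1_def closure_Un using \<epsilon>(1) by (simp add: cl_rect)
      show ?thesis
        unfolding 3
      proof (rule chart_two_sides[OF e _ _ rect L_conn(1)])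
        show "open ({x0-\<epsilon><..<x0+\<epsilon>} \<times> {y1-\<epsilon><..<y1+\<epsilon>})" by (intro open_Times) auto
        show "e z \<notin> J \<longleftrightarrow> z \<in> {x0<..<x0+\<epsilon>} \<times> {y1<..<y1+\<epsilon>} \<union> L1"
          if "z \<in> {x0-\<epsilon><..<x0+\<epsilon>} \<times> {y1-\<epsilon><..<y1+\<epsilon>}" for z
          using that J1[of "fst z" "snd z"] by (cases z) (auto simp: L1_def)
        show "z \<in> closure ({x0<..<x0+\<epsilon>} \<times> {y1<..<y1+\<epsilon>}) \<and> z \<in> closure L1"
          if "z \<in> {x0-\<epsilon><..<x0+\<epsilon>} \<times> {y1-\<epsilon><..<y1+\<epsilon>}" "e z \<in> J" for z
          using that J1[of "fst z" "snd z"] \<epsilon>(1) by (cases z) (auto simp: cl cl_rect)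
      qed (use \<epsilon>(1) in \<open>auto simp: L1_def\<close>)
    next
      case 4
      have cl: "closure L2 = {x0..x0+\<epsilon>} \<times> {y2-\<epsilon>..y2+\<epsilon>} \<union> {x0-\<epsilon>..x0+\<epsilon>} \<times> {y2..y2+\<epsilon>}"
        unfolding L2_def closure_Un using \<epsilon>(1) by (simp add: cl_rect)
      show ?thesis
        unfolding 4
      proof (rule chart_two_sides[OF e _ _ rect L_conn(2)])
        show "open ({x0-\<epsilon><..<x0+\<epsilon>} \<times> {y2-\<epsilon><..<y2+\<epsilon>})" by (intro open_Times) auto
        show "e z \<notin> J \<longleftrightarrow> z \<in> {x0-\<epsilon><..<x0} \<times> {y2-\<epsilon><..<y2} \<union> L2"
          if "z \<in> {x0-\<epsilon><..<x0+\<epsilon>} \<times> {y2-\<epsilon><..<y2+\<epsilon>}" for z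
          using that J2[of "fst z" "snd z"] by (cases z) (auto simp: L2_def)
        show "z \<in> closure ({x0-\<epsilon><..<x0} \<times> {y2-\<epsilon><..<y2}) \<and> z \<in> closure L2"
          if "z \<in> {x0-\<epsilon><..<x0+\<epsilon>} \<times> {y2-\<epsilon><..<y2+\<epsilon>}" "e z \<in> J" for z
          using that J2[of "fst z" "snd z"] \<epsilon>(1) by (cases z) (auto simp: cl cl_rect)
      qed (use \<epsilon>(1) in \<open>auto simp: L2_def\<close>)
    qed
  qed

  have accumulates: "J \<subseteq> M closure_of P" "J \<subseteq> M closure_of P'"
    using separated_part_accumulates[OF connected J_closed J_conn loc P(1,3,2,4,5,6)]
      separated_part_accumulates[OF connected J_closed J_conn loc P(2,4,1,3)] P(5,6)
    by (auto simp: Int_commute Un_commute)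
  \<comment> \<open>Close to \<open>e (x0, c)\<close> there is nothing but \<open>J\<close> and the
    two strips, so a part of the complement that accumulates there must meet one of the
    strips.\<close>
  have not_both: "\<not> e ` (F \<union> B) \<subseteq> Q" if "J \<subseteq> M closure_of Q'" "Q \<inter> Q' = {}" "Q' \<inter> J = {}" for Q Q'
  proof
    assume sub: "e ` (F \<union> B) \<subseteq> Q"
    have "e (x0, c) \<in> M closure_of Q'"
      using that(1) c(1,2) by (auto simp: J_def \<sigma>_iff)
    moreover have "openin M (e ` ({x0-\<epsilon><..<x0+\<epsilon>} \<times> {y1<..<y2}))"
      by (intro open_chart_image e open_Times) auto
    moreover have "e (x0, c) \<in> e ` ({x0-\<epsilon><..<x0+\<epsilon>} \<times> {y1<..<y2})"
      using c(1,2) \<epsilon>(1) by (intro imageI) auto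
    ultimately have "\<exists>q. q \<in> Q' \<and> q \<in> e ` ({x0-\<epsilon><..<x0+\<epsilon>} \<times> {y1<..<y2})"
      by (meson in_closure_of)
    then obtain z where z: "z \<in> {x0-\<epsilon><..<x0+\<epsilon>} \<times> {y1<..<y2}" "e z \<in> Q'"
      by (metis imageE)
    moreover have "e z \<in> J \<or> z \<in> F \<union> B"
      using z J3[of "fst z" "snd z"] by (cases z) (auto simp: F_def B_def)
    ultimately show False using sub that by blast
  qed

  obtain k a b where k: "positive_arc E k a b" "k a = e (x0, y2)" "k b = e (x0, c)"
    using c(3) by (auto simp: reach_def)
  have ab: "a < b"
    using positive_arc_imp_le[OF k(1)] k(2,3) c by (cases "a = b") (auto simp: inj_e)
  \<comment> \<open>The start \<open>k a\<close> lies on \<open>J\<close> itself, so the first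
    return is sought from \<open>r\<close> on; between \<open>a\<close> and \<open>r\<close> the arc
    runs inside \<open>L2\<close>.\<close>
  obtain r where r: "a < r" "r \<le> b"
      "\<And>\<tau>. a < \<tau> \<Longrightarrow> \<tau> \<le> r \<Longrightarrow> \<exists>x'. x0 < x' \<and> x' < x0 + \<epsilon> \<and> k \<tau> = e (x', y2)"
    using positive_arc_leaves[OF k(1) order_refl ab e k(2) \<epsilon>(1)] by blast
  have start: "k \<tau> \<in> e ` L2" if "a < \<tau>" "\<tau> \<le> r" for \<tau>
    using r(3)[OF that] \<epsilon>(1) by (force simp: L2_def)
  define T where "T = {t \<in> {a..b}. k t \<in> J} \<inter> {r..b}"
  have "closedin (top_of_set {a..b}) {t \<in> {a..b}. k t \<in> J}"
    using closedin_continuous_map_preimage[OF positive_arc_continuous[OF k(1)] J_closed] by simp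
  then have "closed {t \<in> {a..b}. k t \<in> J}"
    by (rule closedin_closed_trans) auto
  then have "compact T"
    unfolding T_def by (rule closed_Int_compact) auto
  moreover have "b \<in> T" using ab r c k(3) by (auto simp: T_def J_def \<sigma>_iff)
  ultimately obtain t1 where t1: "t1 \<in> T" "\<And>t. t \<in> T \<Longrightarrow> t1 \<le> t"
    using compact_attains_inf[of T] by blast
  have t1': "r \<le> t1" "t1 \<le> b" "k t1 \<in> J" using t1(1) by (auto simp: T_def)
  have "t1 \<noteq> r" using start[of r] r off_J t1' by auto
  then have rt1: "r < t1" using t1' by simp
  have before: "k t \<notin> J" if "a < t" "t < t1" for t
  proof (cases "t \<le> r")
    case True then show ?thesis using start[of t] that off_J by auto
  next
    case False
    then show ?thesis using t1(2)[of t] that t1' r by (auto simp: T_def)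
  qed
  have "connectedin (top_of_set {a..b}) {a<..<t1}"
    using t1' by (auto simp: connectedin_subtopology)
  then have K_conn: "connectedin M (k ` {a<..<t1})"
    by (rule connectedin_continuous_map_image[OF positive_arc_continuous[OF k(1)]])
  have at1: "a < t1" using r rt1 by simp

  have arrival: "k ` {a<..<t1} \<inter> e ` (L1 \<union> B) \<noteq> {}"
  proof -
    consider t where "u < t" "t < v" "k t1 = g t" | y where "y1 \<le> y" "y \<le> y2" "k t1 = e (x0, y)"
    proof -
      from t1'(3) consider t where "t \<in> {u..v}" "k t1 = g t" | y where "y \<in> {y1..y2}" "k t1 = e (x0, y)"
        by (auto simp: J_def \<sigma>_def)
      then show thesis
      proof cases
        case (1 t)
        then show thesis
          using that(1)[of t] that(2)[of y1] that(2)[of y2] gu gv y12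
          by (metis atLeastAtMost_iff order_le_less order_refl)
      qed (use that(2) in auto)
    qed
    then show ?thesis
    proof cases
      \<comment> \<open>Arrival at an inner point of \<open>g\<close> is impossible: near it both
        arcs run in the same plaque, so \<open>k\<close> would lie on \<open>J\<close> already
        before \<open>t1\<close>.\<close>
      case (1 t)
      then have t: "t \<in> {u..v}" by auto
      have "g t \<in> topspace M" using t1'(3) 1 closedin_subset[OF J_closed] by auto
      then obtain e' x' y' where e': "e' \<in> E" "g t = e' (x', y')"
        using covering by (metis imageE surj_pair)
      obtain s where s: "s > 0" "\<And>x y. \<bar>x - x'\<bar> < s \<Longrightarrow> \<bar>y - y'\<bar> < s \<Longrightarrow> e' (x, y) \<in> g ` {u..v} \<longleftrightarrow> y = y'"
        using positive_arc_trace[OF g t e'] 1 by (metis less_irrefl)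
      obtain \<tau> x where "a < \<tau>" "\<tau> < t1" "x' - s < x" "x < x'" "k \<tau> = e' (x, y')"
        using positive_arc_arrives[OF k(1) at1 t1'(2) e'(1) _ s(1)] 1 e'(2) by metis
      then show ?thesis using s before[of \<tau>] by (auto simp: J_def)
    next
      \<comment> \<open>The corner at \<open>y2\<close> is the start of \<open>k\<close> and is not
        met twice. At every other height the arc comes from the left: from \<open>L1\<close> at the
        height \<open>y1\<close>, from \<open>B\<close> above it.\<close>
      case (2 y)
      have "y \<noteq> y2"
        using 2 k(2) inj_onD[OF positive_arc_imp_inj[OF k(1)], of t1 a] at1 t1'(2) ab by auto
      obtain \<tau> x where *: "a < \<tau>" "\<tau> < t1" "x0 - \<epsilon> < x" "x < x0" "k \<tau> = e (x, y)"
        using positive_arc_arrives[OF k(1) at1 t1'(2) e 2(3) \<epsilon>(1)] by metis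
      have "(x, y) \<in> L1 \<union> B"
        using * 2 \<open>y \<noteq> y2\<close> \<epsilon>(1) by (cases "y = y1") (auto simp: L1_def B_def)
      then have "k \<tau> \<in> e ` (L1 \<union> B)" unfolding *(5) by (rule imageI)
      moreover have "k \<tau> \<in> k ` {a<..<t1}" by (rule imageI) (use * in simp)
      ultimately show ?thesis by blast
    qed
  qed
  have departure: "e ` (L2 \<union> F) \<inter> k ` {a<..<t1} \<noteq> {}"
  proof -
    have "k r \<in> e ` (L2 \<union> F)" using start[of r] r(1) by blast
    moreover have "k r \<in> k ` {a<..<t1}" by (rule imageI) (use r(1) rt1 in simp)
    ultimately show ?thesis by blast
  qed

  have m: "y1 + \<epsilon>/2 < y2" "y1 < y2 - \<epsilon>/2" using \<epsilon> by linarith+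
  then have "(x0 + \<epsilon>/2, y2 - \<epsilon>/2) \<in> L2 \<inter> F" "(x0 - \<epsilon>/2, y1 + \<epsilon>/2) \<in> L1 \<inter> B"
    using \<epsilon>(1) by (auto simp: L1_def L2_def F_def B_def)
  then have "connected (L2 \<union> F)" "connected (L1 \<union> B)"
    using L_conn F_conn B_conn by (auto intro!: connected_Un)
  then have cc: "connectedin M (e ` (L2 \<union> F))" "connectedin M (e ` (L1 \<union> B))"
    using e by (auto intro!: connectedin_chart_image)
  \<comment> \<open>The stretch of \<open>k\<close> before \<open>t1\<close> is a bridge off the
    curve between the two sides of the segment, so both strips lie in the same part of the
    complement.\<close>
  define C where "C = e ` (L2 \<union> F) \<union> k ` {a<..<t1} \<union> e ` (L1 \<union> B)"
  have "connectedin M C"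
    unfolding C_def using departure arrival by (intro connectedin_Un cc K_conn) auto
  moreover have "C \<inter> J = {}"
    using off_J before by (auto simp: C_def)
  ultimately have "C \<subseteq> P \<or> C \<subseteq> P'"
    using connectedinD[of M C P P'] P connectedin_subset_topspace[of M C] by blast
  moreover have "e ` (F \<union> B) \<subseteq> C" by (auto simp: C_def)
  moreover have "P \<inter> J = {}" "P' \<inter> J = {}" by (auto simp: P_def P'_def)
  ultimately show False
    using not_both[of P' P] not_both[of P P'] accumulates P(5) by blast
qed

text \<open>The leaf lies in the orbit of \<open>g\<close>. An inner point of the segment is not on
  the arc by \<open>off\<close>, does not follow it by \<open>no_forward_return\<close>, and does
  not precede it by the same lemma in the mirror image.\<close>

lemma no_return:
  assumes dich: "dichotomic M" and e: "e \<in> E" and g: "positive_arc E g u v"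
    and gu: "g u = e (x0, y1)" and gv: "g v = e (x0, y2)" and y12: "y1 < y2"
    and off: "\<And>t y. u < t \<Longrightarrow> t < v \<Longrightarrow> y \<in> {y1..y2} \<Longrightarrow> g t \<noteq> e (x0, y)"
    and L: "indecomposable E L" "g u \<in> L" and c: "y1 < c" "c < y2"
  shows "e (x0, c) \<notin> L"
proof
  assume "e (x0, c) \<in> L"
  then have "e (x0, c) \<in> orbit g u v"
    using indecomposable_subset_orbit[OF g L] by blast
  then consider t where "t \<in> {u..v}" "g t = e (x0, c)" | "reach E (e (x0, y2)) (e (x0, c))"
    | "reach E (e (x0, c)) (e (x0, y1))"
    using gu gv by (auto simp: orbit_def)
  then show False
  proof cases
    case (1 t)
    then show False
      using off[of t c] c gu gv chart_eq_iff[OF e] by (cases "t = u"; cases "t = v") auto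
  next
    case 2
    then show False using no_forward_return[OF dich e g gu gv y12 off c] by blast
  next
    case 3
    interpret m: directed_atlas M "mirror E" by (rule directed_atlas_mirror)
    \<comment> \<open>This is a half turn of the chart. Reversing the orientation exchanges the ends
      of the arc, and turning the transversal upside down restores the order of their
      heights.\<close>
    define e' where "e' = (\<lambda>(x, y). e (- x, - y))"
    have e': "e' \<in> mirror E"
      unfolding mirror_def e'_def by (rule image_eqI[OF _ flip[OF e]]) auto
    have "reach (mirror E) (e' (- x0, - y1)) (e' (- x0, - c))"
      using 3 by (simp add: e'_def reach_mirror)
    moreover have "g (- t) \<noteq> e' (- x0, y)" if "- v < t" "t < - u" "y \<in> {- y2..- y1}" for t y
      using off[of "- t" "- y"] that by (auto simp: e'_def)
    ultimately show False
      using m.no_forward_return[OF dich e' positive_arc_mirror[OF g], of "- x0" "- y2" "- y1" "- c"]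
        gu gv y12 c by (auto simp: e'_def)
  qed
qed

section \<open>Gaps of a leaf on a transversal\<close>

lemma reach_imp_gap:
  assumes dich: "dichotomic M" and e: "e \<in> E" and L: "indecomposable E L" "e (x0, y1) \<in> L"
    and y12: "y1 < y2" and r: "reach E (e (x0, y1)) (e (x0, y2))"
  obtains y' where "y1 < y'" "y' \<le> y2" "\<And>c. y1 < c \<Longrightarrow> c < y' \<Longrightarrow> e (x0, c) \<notin> L"
proof -
  obtain g u v where g: "positive_arc E g u v" "g u = e (x0, y1)" "g v = e (x0, y2)"
    using r by (auto simp: reach_def)
  have inj_e: "e (a, b) = e (a', b') \<longleftrightarrow> a = a' \<and> b = b'" for a b a' b'
    using e by (rule chart_eq_iff)
  have uv: "u < v"
    using positive_arc_imp_le[OF g(1)] g(2,3) y12 by (cases "u = v") (auto simp: inj_e)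
  \<comment> \<open>On this initial stretch the arc is off the segment, to the right of it, so the
    first return can be sought in the compact interval \<open>{s..v}\<close>. The width
    \<open>1\<close> is arbitrary.\<close>
  obtain s where s: "u < s" "s \<le> v"
      "\<And>\<tau>. u < \<tau> \<Longrightarrow> \<tau> \<le> s \<Longrightarrow> \<exists>x'. x0 < x' \<and> x' < x0 + 1 \<and> g \<tau> = e (x', y1)"
    using positive_arc_leaves[OF g(1) order_refl uv e g(2), of 1] by auto
  define \<sigma> where "\<sigma> = e ` ({x0} \<times> {y1..y2})"
  have "closedin M \<sigma>"
    unfolding \<sigma>_def
    by (intro compactin_imp_closedin hausdorff image_compactin[OF _ continuous[OF e]])
      (auto intro: compact_Times)
  then have "closedin (top_of_set {u..v}) {t \<in> {u..v}. g t \<in> \<sigma>}"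
    using closedin_continuous_map_preimage[OF positive_arc_continuous[OF g(1)]] by auto
  then have "closed {t \<in> {u..v}. g t \<in> \<sigma>}"
    by (rule closedin_closed_trans) auto
  then have "compact ({t \<in> {u..v}. g t \<in> \<sigma>} \<inter> {s..v})"
    by (rule closed_Int_compact) auto
  moreover have "v \<in> {t \<in> {u..v}. g t \<in> \<sigma>} \<inter> {s..v}"
    using uv s g(3) y12 by (auto simp: \<sigma>_def)
  \<comment> \<open>The arc may cross the segment several times before it ends at \<open>y2\<close>.
    Cut at its first return, it satisfies the hypotheses of \<open>no_return\<close> over the
    possibly shorter segment from \<open>y1\<close> to \<open>y'\<close>.\<close>
  ultimately obtain t1 where t1: "t1 \<in> {t \<in> {u..v}. g t \<in> \<sigma>} \<inter> {s..v}"
      "\<And>t. t \<in> {t \<in> {u..v}. g t \<in> \<sigma>} \<inter> {s..v} \<Longrightarrow> t1 \<le> t"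
    using compact_attains_inf[of "{t \<in> {u..v}. g t \<in> \<sigma>} \<inter> {s..v}"] by blast
  then obtain y' where y': "g t1 = e (x0, y')" "y1 \<le> y'" "y' \<le> y2" "s \<le> t1" "t1 \<le> v"
    by (auto simp: \<sigma>_def)
  have "g t1 \<noteq> g u"
    using inj_onD[OF positive_arc_imp_inj[OF g(1)], of t1 u] y' s uv by auto
  then have lt: "y1 < y'" using y' g(2) by (cases "y' = y1") auto
  have off: "g t \<noteq> e (x0, y)" if t: "u < t" "t < t1" "y \<in> {y1..y'}" for t y
  proof (cases "t \<le> s")
    case True then show ?thesis using s(3)[of t] t by (auto simp: inj_e)
  next
    case False
    have "g t \<notin> \<sigma>" using t1(2)[of t] t False y' uv by auto
    then show ?thesis using t y' by (auto simp: \<sigma>_def)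
  qed
  have arc: "positive_arc E g u t1"
    by (rule positive_arc_subinterval[OF g(1)]) (use y' s in auto)
  have "g u \<in> L" using L(2) g(2) by simp
  with no_return[OF dich e arc g(2) y'(1) lt off L(1)] show thesis
    by (intro that[OF lt y'(3)])
qed

text \<open>Where its closure has interior, a saturated set meets short transversals in dense
  subsets. Of two points of the leaf on such a transversal one reaches the other, and this opens a
  gap next to the point where the arc starts.\<close>

lemma leaf_nowhere_dense:
  assumes dich: "dichotomic M" and L: "saturated E L" "indecomposable E L"
  shows "M interior_of (M closure_of L) = {}"
proof (rule ccontr)
  define W where "W = M interior_of (M closure_of L)"
  assume "M interior_of (M closure_of L) \<noteq> {}"
  then obtain p where p: "p \<in> W" by (auto simp: W_def)
  have W: "openin M W" "W \<subseteq> M closure_of L"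
    by (auto simp: W_def interior_of_subset)
  then have "p \<in> topspace M" using p openin_subset by blast
  then obtain e x0 y0 where e: "e \<in> E" "p = e (x0, y0)"
    using covering by (metis imageE surj_pair)
  obtain \<epsilon> where \<epsilon>: "\<epsilon> > 0"
      "\<And>x y. \<bar>x - x0\<bar> < \<epsilon> \<Longrightarrow> \<bar>y - y0\<bar> < \<epsilon> \<Longrightarrow> e (x, y) \<notin> topspace M - W"
    using open_chart_square[OF e(1), of "topspace M - W" x0 y0] p e(2) W(1) by auto
  have dense: "\<exists>y. a < y \<and> y < b \<and> e (x0, y) \<in> L" if ab: "a < b" "y0 - \<epsilon> < a" "b < y0 + \<epsilon>" for a b
  proof -
    define m where "m = (a + b) / 2"
    have m: "a < m" "m < b" using ab by (auto simp: m_def)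
    then have "\<bar>m - y0\<bar> < \<epsilon>" using ab by auto
    then have "e (x0, m) \<in> W" using \<epsilon>(2)[of x0 m] \<epsilon>(1) chart_in_topspace[OF e(1)] by auto
    then have "e (x0, m) \<in> M closure_of L" using W(2) by blast
    \<comment> \<open>The neighbourhood is a full band of plaques, so a point of \<open>L\<close>
      found in it can be moved along its plaque to the vertical line at \<open>x0\<close>.\<close>
    moreover have "e (x0, m) \<in> e ` (UNIV \<times> {a<..<b})" using m by (intro imageI) auto
    moreover have "openin M (e ` (UNIV \<times> {a<..<b}))"
      by (intro open_chart_image e open_Times) auto
    ultimately have "\<exists>q. q \<in> L \<and> q \<in> e ` (UNIV \<times> {a<..<b})"
      by (meson in_closure_of)
    then obtain x y where "e (x, y) \<in> L" "a < y" "y < b" by auto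
    then show ?thesis using L(1) e(1) unfolding saturated_def by blast
  qed
  have no_reach: "\<not> reach E (e (x0, y1)) (e (x0, y2))"
    if y: "y1 \<noteq> y2" "\<bar>y1 - y0\<bar> < \<epsilon>" "\<bar>y2 - y0\<bar> < \<epsilon>" "e (x0, y1) \<in> L" for y1 y2
  proof
    assume r: "reach E (e (x0, y1)) (e (x0, y2))"
    show False
    proof (cases "y1 < y2")
      case True
      obtain y' where y': "y1 < y'" "y' \<le> y2" "\<And>c. y1 < c \<Longrightarrow> c < y' \<Longrightarrow> e (x0, c) \<notin> L"
        using reach_imp_gap[OF dich e(1) L(2) y(4) True r] by blast
      have "\<exists>c. y1 < c \<and> c < y' \<and> e (x0, c) \<in> L"
        using y y' by (intro dense) (auto simp: abs_less_iff)
      then show False using y'(3) by blast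
    next
      case False
      \<comment> \<open>Upside down, the starting point of the arc is again the lower one; in the
        original chart the gap lies just below \<open>y1\<close>.\<close>
      define e' where "e' = (\<lambda>(x, y). e (x, - y))"
      have e': "e' \<in> E" unfolding e'_def by (rule flip[OF e(1)])
      obtain y' where y': "- y1 < y'" "y' \<le> - y2" "\<And>c. - y1 < c \<Longrightarrow> c < y' \<Longrightarrow> e' (x0, c) \<notin> L"
        using reach_imp_gap[OF dich e' L(2), of x0 "- y1" "- y2"] False y r
        by (auto simp: e'_def)
      have "\<exists>c. - y' < c \<and> c < y1 \<and> e (x0, c) \<in> L"
        using y y' by (intro dense) (auto simp: abs_less_iff)
      then obtain c where "- y' < c" "c < y1" "e (x0, c) \<in> L" by blast
      then show False using y'(3)[of "- c"] by (auto simp: e'_def)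
    qed
  qed
  obtain y1 where y1: "y0 - \<epsilon> / 2 < y1" "y1 < y0" "e (x0, y1) \<in> L"
    using dense[of "y0 - \<epsilon> / 2" y0] \<epsilon>(1) by auto
  obtain y2 where y2: "y0 < y2" "y2 < y0 + \<epsilon> / 2" "e (x0, y2) \<in> L"
    using dense[of y0 "y0 + \<epsilon> / 2"] \<epsilon>(1) by auto
  \<comment> \<open>The orbit of the trivial arc at a point consists of this point, those reached
    from it and those that reach it, so any two points of the leaf are comparable.\<close>
  have "e (x0, y2) \<in> orbit (\<lambda>x. e (x, y1)) x0 x0"
    using indecomposable_subset_orbit[OF positive_arc_plaque[OF e(1) order_refl] L(2) y1(3)] y2(3)
    by blast
  then have "reach E (e (x0, y1)) (e (x0, y2)) \<or> reach E (e (x0, y2)) (e (x0, y1))"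
    using y1 y2 chart_eq_iff[OF e(1)] by (auto simp: orbit_def)
  then show False
    using no_reach[of y1 y2] no_reach[of y2 y1] y1 y2 \<epsilon>(1) by (auto simp: abs_less_iff)
qed

end

section \<open>The directed atlas of an oriented foliation\<close>

lemma open_vimage_continuous_map:
  "continuous_map euclidean X c \<Longrightarrow> openin X W \<Longrightarrow> open (c -` W)"
  using openin_continuous_map_preimage[of euclidean X c W] by (simp add: vimage_def)

lemma plane_chart_inverse:
  assumes "plane_chart M U \<phi>"
  obtains \<psi> where "\<And>z. \<psi> z \<in> U" "\<And>z. \<phi> (\<psi> z) = z" "\<And>q. q \<in> U \<Longrightarrow> \<psi> (\<phi> q) = q"
    "continuous_map euclidean M \<psi>" "open_map euclidean M \<psi>"
proof -
  have U: "openin M U" "topspace (subtopology M U) = U"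
    using assms openin_subset by (auto simp: plane_chart_def)
  obtain \<psi> where \<psi>: "homeomorphic_maps (subtopology M U) euclidean \<phi> \<psi>"
    using assms by (auto simp: plane_chart_def homeomorphic_map_maps)
  have c: "continuous_map euclidean (subtopology M U) \<psi>"
    using \<psi> by (simp add: homeomorphic_maps_def)
  then have r: "\<psi> z \<in> U" for z
    using U(2) by (auto simp: continuous_map_def)
  have "open_map euclidean (subtopology M U) \<psi>"
    using \<psi> homeomorphic_imp_open_map by (auto simp: homeomorphic_maps_map)
  then have "open_map euclidean M \<psi>"
    using U(1) unfolding open_map_def by (auto simp: openin_open_subtopology)
  moreover have "continuous_map euclidean M \<psi>"
    using c by (rule continuous_map_into_fulltopology)
  moreover have "\<phi> (\<psi> z) = z" "q \<in> U \<Longrightarrow> \<psi> (\<phi> q) = q" for z q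
    using \<psi> U(2) unfolding homeomorphic_maps_def by (cases z, auto)
  ultimately show thesis
    using r by (intro that)
qed

lemma foliation_plane_chart: "foliation M \<A> \<Longrightarrow> (U, \<phi>) \<in> \<A> \<Longrightarrow> plane_chart M U \<phi>"
  by (auto simp: foliation_def)

lemma foliation_cover: "foliation M \<A> \<Longrightarrow> p \<in> topspace M \<Longrightarrow> \<exists>U \<phi>. (U, \<phi>) \<in> \<A> \<and> p \<in> U"
  unfolding foliation_def by blast

lemma foliation_transition:
  assumes "foliation M \<A>" "(U, \<phi>) \<in> \<A>" "(V, \<psi>) \<in> \<A>" "p \<in> U" "p \<in> V"
  obtains W where "openin M W" "p \<in> W" "W \<subseteq> U \<inter> V"
    "\<And>q. q \<in> W \<Longrightarrow> snd (\<phi> q) = snd (\<phi> p) \<Longrightarrow> snd (\<psi> q) = snd (\<psi> p)"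
proof -
  have "\<exists>W g. openin M W \<and> p \<in> W \<and> W \<subseteq> U \<inter> V \<and> (\<forall>q\<in>W. snd (\<psi> q) = g (snd (\<phi> q)))"
    using assms unfolding foliation_def by blast
  then show thesis using that by metis
qed

lemma openin_leaf_topology_plaque:
  "P \<in> plaques \<A> \<Longrightarrow> openin M W \<Longrightarrow> openin (leaf_topology M \<A>) (P \<inter> W)"
  unfolding leaf_topology_def by (intro topology_generated_by_Basis) blast

lemma topspace_leaf_topology:
  assumes "foliation M \<A>"
  shows "topspace (leaf_topology M \<A>) = topspace M"
proof
  show "topspace (leaf_topology M \<A>) \<subseteq> topspace M"
    unfolding leaf_topology_def using openin_subset by fastforce
  show "topspace M \<subseteq> topspace (leaf_topology M \<A>)"
  proof
    fix p assume p: "p \<in> topspace M"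
    then obtain U \<phi> where U: "(U, \<phi>) \<in> \<A>" "p \<in> U"
      using foliation_cover[OF assms] by blast
    then have "{q \<in> U. snd (\<phi> q) = snd (\<phi> p)} \<in> plaques \<A>"
      by (auto simp: plaques_def)
    then have "openin (leaf_topology M \<A>) ({q \<in> U. snd (\<phi> q) = snd (\<phi> p)} \<inter> topspace M)"
      by (rule openin_leaf_topology_plaque) simp
    then show "p \<in> topspace (leaf_topology M \<A>)"
      using openin_subset U(2) p by blast
  qed
qed

text \<open>A curve of constant height in one chart also has, near each of its points, constant
  height in any other chart there, because coordinate changes match heights locally. Hence preimages
  of the generating sets of the leaf topology are open.\<close>

lemma continuous_map_leaf_topology:
  fixes c :: "real \<Rightarrow> 'a"
  assumes fol: "foliation M \<A>" and V: "(V, \<psi>) \<in> \<A>" and c: "continuous_map euclidean M c"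
    and y: "\<And>r. c r \<in> V" "\<And>r. snd (\<psi> (c r)) = y"
  shows "continuous_map euclidean (leaf_topology M \<A>) c"
  unfolding leaf_topology_def
proof (rule continuous_on_generated_topo)
  show "c ` topspace euclidean \<subseteq> \<Union> {P \<inter> W |P W. P \<in> plaques \<A> \<and> openin M W}"
    using topspace_leaf_topology[OF fol] c
    by (auto simp: leaf_topology_def continuous_map_def)
  fix B assume "B \<in> {P \<inter> W |P W. P \<in> plaques \<A> \<and> openin M W}"
  then obtain U \<phi> k W where B: "B = {q \<in> U. snd (\<phi> q) = k} \<inter> W" "(U, \<phi>) \<in> \<A>" "openin M W"
    by (auto simp: plaques_def)
  have "open (c -` B)"
  proof (subst open_subopen, intro ballI)
    fix r assume "r \<in> c -` B"
    then have r: "c r \<in> U" "snd (\<phi> (c r)) = k" "c r \<in> W" by (auto simp: B)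
    obtain W' where W': "openin M W'" "c r \<in> W'" "W' \<subseteq> V \<inter> U"
      "\<And>q. q \<in> W' \<Longrightarrow> snd (\<psi> q) = snd (\<psi> (c r)) \<Longrightarrow> snd (\<phi> q) = snd (\<phi> (c r))"
      using foliation_transition[OF fol V B(2) y(1) r(1)] by metis
    have "open (c -` (W' \<inter> W))"
      by (rule open_vimage_continuous_map[OF c openin_Int[OF W'(1) B(3)]])
    moreover have "c -` (W' \<inter> W) \<subseteq> c -` B"
      using W'(3,4) y(2) r(2) by (auto simp: B)
    ultimately show "\<exists>T. open T \<and> r \<in> T \<and> T \<subseteq> c -` B"
      using W'(2) r(3) by blast
  qed
  then show "openin euclidean (c -` B \<inter> topspace euclidean)" by simp
qed

lemma leaves_contain_curve:
  fixes c :: "real \<Rightarrow> 'a"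
  assumes "L \<in> leaves M \<A>" "continuous_map euclidean (leaf_topology M \<A>) c" "c r \<in> L"
  shows "range c \<subseteq> L"
proof (rule path_components_of_maximal)
  show "L \<in> path_components_of (leaf_topology M \<A>)"
    using assms(1) by (simp add: leaves_def)
  show "path_connectedin (leaf_topology M \<A>) (range c)"
    by (rule path_connectedin_continuous_map_image[OF assms(2)]) simp
  show "\<not> disjnt L (range c)" using assms(3) by (auto simp: disjnt_iff)
qed

lemma leaf_through:
  assumes "foliation M \<A>" "p \<in> topspace M"
  obtains L where "L \<in> leaves M \<A>" "p \<in> L"
  using assms topspace_leaf_topology[OF assms(1)] Union_path_components_of[of "leaf_topology M \<A>"]
  unfolding leaves_def by blast

section \<open>Leaf orientations compared with charts\<close>

lemma orientation_chart_at:
  assumes or: "oriented_foliation M \<A> Or" and p: "p \<in> topspace M"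
  obtains L I h where "L \<in> leaves M \<A>" "p \<in> L" "(I, h) \<in> Or L" "p \<in> I" "inj_on h I"
    "openin (subtopology (leaf_topology M \<A>) L) I"
proof -
  have fol: "foliation M \<A>" using or by (simp add: oriented_foliation_def)
  obtain L where L: "L \<in> leaves M \<A>" "p \<in> L" using leaf_through[OF fol p] .
  have o: "orientation_1 (subtopology (leaf_topology M \<A>) L) (Or L)"
    using or L by (simp add: oriented_foliation_def)
  have "(\<Union>(I, h)\<in>Or L. I) = topspace (subtopology (leaf_topology M \<A>) L)"
    using o by (simp add: orientation_1_def)
  moreover have "p \<in> topspace (subtopology (leaf_topology M \<A>) L)"
    using L p topspace_leaf_topology[OF fol] by simp
  ultimately obtain I h where I: "(I, h) \<in> Or L" "p \<in> I" by blast
  then have oI: "openin (subtopology (leaf_topology M \<A>) L) I"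
    "homeomorphic_map (subtopology (subtopology (leaf_topology M \<A>) L) I) (top_of_set (h ` I)) h"
    using o by (auto simp: orientation_1_def)
  have "topspace (subtopology (subtopology (leaf_topology M \<A>) L) I) = I"
    using openin_subset[OF oI(1)] by auto
  then have "inj_on h I"
    using homeomorphic_imp_injective_map[OF oI(2)] by simp
  then show thesis using that[OF L I _ oI(1)] by blast
qed

lemma plane_chart_plaque_curve:
  assumes fol: "foliation M \<A>" and U: "(U, \<phi>) \<in> \<A>" and L: "L \<in> leaves M \<A>" and p: "p \<in> U" "p \<in> L"
  obtains c where "continuous_map euclidean (subtopology (leaf_topology M \<A>) L) c"
    "continuous_map euclidean M c" "\<And>x. c x \<in> U" "\<And>x. \<phi> (c x) = (x, snd (\<phi> p))" "c (fst (\<phi> p)) = p"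
proof -
  obtain \<psi> where \<psi>: "\<And>z. \<psi> z \<in> U" "\<And>z. \<phi> (\<psi> z) = z" "\<And>q. q \<in> U \<Longrightarrow> \<psi> (\<phi> q) = q"
      "continuous_map euclidean M \<psi>"
    using plane_chart_inverse[OF foliation_plane_chart[OF fol U]] by metis
  define c where "c x = \<psi> (x, snd (\<phi> p))" for x
  have "continuous_on UNIV (\<lambda>x. (x, snd (\<phi> p)))" by (intro continuous_intros)
  then have "continuous_map euclidean euclidean (\<lambda>x. (x, snd (\<phi> p)))" by simp
  from continuous_map_compose[OF this \<psi>(4)]
  have c: "continuous_map euclidean M c" by (simp add: o_def c_def[abs_def])
  have cp: "c (fst (\<phi> p)) = p" using \<psi>(3)[OF p(1)] by (simp add: c_def)
  have cT: "continuous_map euclidean (leaf_topology M \<A>) c"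
    by (rule continuous_map_leaf_topology[OF fol U c]) (simp_all add: c_def \<psi>)
  then have "range c \<subseteq> L"
    using leaves_contain_curve[OF L, of c "fst (\<phi> p)"] cp p(2) by simp
  then have "continuous_map euclidean (subtopology (leaf_topology M \<A>) L) c"
    using cT by (auto simp: continuous_map_in_subtopology)
  then show thesis using that[of c] c cp \<psi> by (simp add: c_def)
qed

lemma direction_in_chart_atD:
  assumes "direction_in_chart_at M \<A> Or \<phi> s q" "L \<in> leaves M \<A>" "(I, h) \<in> Or L" "q \<in> I"
  obtains W where "openin (subtopology (leaf_topology M \<A>) L) W" "q \<in> W"
    "\<And>x y. x \<in> W \<Longrightarrow> y \<in> W \<Longrightarrow> h x < h y \<Longrightarrow> s * fst (\<phi> x) < s * fst (\<phi> y)"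
proof -
  have "same_direction_at (subtopology (leaf_topology M \<A>) L) h (\<lambda>x. s * fst (\<phi> x)) q"
    using bspec[OF bspec[OF assms(1)[unfolded direction_in_chart_at_def] assms(2)] assms(3)] assms(4)
    by simp
  then show thesis
    using that unfolding same_direction_at_def by blast
qed

text \<open>The plaque contains points other than \<open>p\<close> that are close to
  \<open>p\<close> in the leaf. By injectivity such a point differs from \<open>p\<close> in its
  value of the orientation chart \<open>h\<close>, and the first coordinates of the two would have
  to be ordered both ways.\<close>

lemma direction_unique:
  assumes or: "oriented_foliation M \<A> Or" and U: "(U, \<phi>) \<in> \<A>" and p: "p \<in> U"
    and pos: "direction_in_chart_at M \<A> Or \<phi> 1 p" and neg: "direction_in_chart_at M \<A> Or \<phi> (- 1) p"
  shows False
proof -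
  have fol: "foliation M \<A>" using or by (simp add: oriented_foliation_def)
  have "p \<in> topspace M"
    using foliation_plane_chart[OF fol U] p openin_subset by (auto simp: plane_chart_def)
  then obtain L I h where L: "L \<in> leaves M \<A>" "p \<in> L" "(I, h) \<in> Or L" "p \<in> I" "inj_on h I"
      "openin (subtopology (leaf_topology M \<A>) L) I"
    using orientation_chart_at[OF or] by metis
  let ?T = "subtopology (leaf_topology M \<A>) L"
  obtain W1 where W1: "openin ?T W1" "p \<in> W1" "\<And>x y. x \<in> W1 \<Longrightarrow> y \<in> W1 \<Longrightarrow> h x < h y \<Longrightarrow> 1 * fst (\<phi> x) < 1 * fst (\<phi> y)"
    using direction_in_chart_atD[OF pos L(1,3,4)] by metis
  obtain W2 where W2: "openin ?T W2" "p \<in> W2" "\<And>x y. x \<in> W2 \<Longrightarrow> y \<in> W2 \<Longrightarrow> h x < h y \<Longrightarrow> - 1 * fst (\<phi> x) < - 1 * fst (\<phi> y)"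
    using direction_in_chart_atD[OF neg L(1,3,4)] by metis
  obtain c where c: "continuous_map euclidean ?T c" "\<And>x. \<phi> (c x) = (x, snd (\<phi> p))" "c (fst (\<phi> p)) = p"
    using plane_chart_plaque_curve[OF fol U L(1) p L(2)] by metis
  have "openin ?T (W1 \<inter> W2 \<inter> I)" using W1 W2 L by blast
  then have "open (c -` (W1 \<inter> W2 \<inter> I))"
    by (rule open_vimage_continuous_map[OF c(1)])
  moreover have "fst (\<phi> p) \<in> c -` (W1 \<inter> W2 \<inter> I)" using W1 W2 L c by simp
  ultimately obtain r where r: "r > 0" "ball (fst (\<phi> p)) r \<subseteq> c -` (W1 \<inter> W2 \<inter> I)"
    by (meson open_contains_ball)
  define q where "q = c (fst (\<phi> p) + r / 2)"
  have "fst (\<phi> p) + r / 2 \<in> ball (fst (\<phi> p)) r" using r(1) by (auto simp: dist_real_def)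
  then have q: "q \<in> W1" "q \<in> W2" "q \<in> I" using r(2) by (auto simp: q_def)
  have f: "fst (\<phi> q) \<noteq> fst (\<phi> p)" using r(1) by (simp add: q_def c)
  then have "h q \<noteq> h p" using inj_onD[OF L(5), of q p] q L by auto
  then consider "h q < h p" | "h p < h q" by linarith
  then show False
    by cases (use W1 W2 q in force)+
qed

text \<open>An oriented foliation prescribes the sign only locally. The domain of a chart is
  connected, being an image of the plane, and the two signs exclude each other at each
  point.\<close>

lemma direction_constant:
  assumes or: "oriented_foliation M \<A> Or" and U: "(U, \<phi>) \<in> \<A>"
  obtains s where "s \<in> {1, - 1}" "\<And>q. q \<in> U \<Longrightarrow> direction_in_chart_at M \<A> Or \<phi> s q"
proof -
  have fol: "foliation M \<A>" using or by (simp add: oriented_foliation_def)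
  obtain \<psi> where \<psi>: "\<And>z. \<psi> z \<in> U" "\<And>q. q \<in> U \<Longrightarrow> \<psi> (\<phi> q) = q" "continuous_map euclidean M \<psi>"
    using plane_chart_inverse[OF foliation_plane_chart[OF fol U]] by metis
  have "U \<subseteq> range \<psi>" using \<psi>(2) by (metis rangeI subsetI)
  then have "U = range \<psi>" using \<psi>(1) by blast
  then have conn: "connectedin M U"
    using connectedin_continuous_map_image[OF \<psi>(3), of UNIV] connected_UNIV by simp
  define D where "D s = \<Union>{V. openin M V \<and> V \<subseteq> U \<and> (\<forall>q\<in>V. direction_in_chart_at M \<A> Or \<phi> s q)}" for s
  have D: "openin M (D s)" "D s \<subseteq> U" "q \<in> D s \<Longrightarrow> direction_in_chart_at M \<A> Or \<phi> s q" for s q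
    by (auto simp: D_def)
  have cover: "U \<subseteq> D 1 \<union> D (- 1)"
  proof
    fix p assume "p \<in> U"
    then have "\<exists>V. openin M V \<and> p \<in> V \<and> V \<subseteq> U \<and>
        (\<exists>s\<in>{1, -1}. \<forall>q\<in>V. direction_in_chart_at M \<A> Or \<phi> s q)"
      using or U unfolding oriented_foliation_def by blast
    then show "p \<in> D 1 \<union> D (- 1)" by (auto simp: D_def)
  qed
  have disj: "D 1 \<inter> D (- 1) = {}"
    using direction_unique[OF or U] D by blast
  have "D 1 \<inter> U = {} \<or> D (- 1) \<inter> U = {}"
    using connectedinD[OF conn D(1) D(1) cover] disj by blast
  then show thesis
    using cover D(3) that[of 1] that[of "- 1"] by blast
qed

text \<open>These are inverse charts with possibly reversed axes. The sign \<open>s\<close> makes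
  the first coordinate follow the orientation; \<open>s'\<close> is free, so that the family is
  closed under turning transversals upside down.\<close>

definition oriented_charts ::
    "'a topology \<Rightarrow> 'a atlas2 \<Rightarrow> ('a set \<Rightarrow> 'a atlas1) \<Rightarrow> (real \<times> real \<Rightarrow> 'a) set" where
  "oriented_charts M \<A> Or = {e. \<exists>U \<phi> s s'. (U, \<phi>) \<in> \<A> \<and> s \<in> {1, - 1} \<and> s' \<in> {1, - 1} \<and>
     (\<forall>q\<in>U. direction_in_chart_at M \<A> Or \<phi> s q) \<and> range e = U \<and> (\<forall>x y. \<phi> (e (x, y)) = (s * x, s' * y))}"

lemma oriented_chartsE:
  assumes "e \<in> oriented_charts M \<A> Or"
  obtains U \<phi> s s' where "(U, \<phi>) \<in> \<A>" "s * s = 1" "s' * s' = 1"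
     "\<And>q. q \<in> U \<Longrightarrow> direction_in_chart_at M \<A> Or \<phi> s q" "range e = U"
     "\<And>x y. \<phi> (e (x, y)) = (s * x, s' * y)"
proof -
  obtain U \<phi> s s' where "(U, \<phi>) \<in> \<A>" "s \<in> {1, - 1}" "s' \<in> {1, - 1}"
     "\<forall>q\<in>U. direction_in_chart_at M \<A> Or \<phi> s q" "range e = U" "\<forall>x y. \<phi> (e (x, y)) = (s * x, s' * y)"
    using assms unfolding oriented_charts_def by blast
  moreover from this have "s * s = 1" "s' * s' = 1" by auto
  ultimately show thesis by (intro that) blast+
qed

lemma oriented_chart_embedding:
  assumes fol: "foliation M \<A>" and e: "e \<in> oriented_charts M \<A> Or"
  shows "continuous_map euclidean M e" "open_map euclidean M e" "inj e"
proof -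
  obtain U \<phi> s s' where *: "(U, \<phi>) \<in> \<A>" "s * s = 1" "s' * s' = 1" "range e = U"
     "\<And>x y. \<phi> (e (x, y)) = (s * x, s' * y)"
    using oriented_chartsE[OF e] by metis
  obtain \<psi> where \<psi>: "\<And>q. q \<in> U \<Longrightarrow> \<psi> (\<phi> q) = q"
      "continuous_map euclidean M \<psi>" "open_map euclidean M \<psi>"
    using plane_chart_inverse[OF foliation_plane_chart[OF fol *(1)]] by metis
  \<comment> \<open>The signs square to one, so \<open>\<rho>\<close> is its own inverse and hence a
    homeomorphism of the plane.\<close>
  define \<rho> :: "real \<times> real \<Rightarrow> real \<times> real" where "\<rho> = (\<lambda>(x, y). (s * x, s' * y))"
  have e\<rho>: "e = \<psi> \<circ> \<rho>"
  proof
    fix z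
    have "e z \<in> U" using *(4) by auto
    from \<psi>(1)[OF this] show "e z = (\<psi> \<circ> \<rho>) z" using *(5) by (cases z) (simp add: \<rho>_def)
  qed
  have \<rho>\<rho>: "\<rho> (\<rho> z) = z" for z
    using *(2,3) by (cases z) (simp add: \<rho>_def flip: mult.assoc)
  have \<rho>: "continuous_on UNIV \<rho>"
    unfolding \<rho>_def case_prod_unfold by (intro continuous_intros)
  have "open (\<rho> ` S)" if "open S" for S
  proof -
    have "\<rho> ` S = \<rho> -` S"
    proof (intro equalityI subsetI)
      fix z assume "z \<in> \<rho> -` S"
      then show "z \<in> \<rho> ` S" using \<rho>\<rho>[of z] by (intro image_eqI[of _ _ "\<rho> z"]) auto
    qed (use \<rho>\<rho> in auto)
    then show ?thesis using that \<rho> by (simp add: continuous_on_open_vimage)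
  qed
  then have "open_map euclidean euclidean \<rho>" by (auto simp: open_map_def)
  then show "open_map euclidean M e" unfolding e\<rho> using \<psi>(3) by (rule open_map_compose)
  show "continuous_map euclidean M e"
    unfolding e\<rho> using \<rho> \<psi>(2) by (intro continuous_map_compose[of _ euclidean]) auto
  show "inj e"
  proof (rule injI)
    fix z w assume "e z = e w"
    moreover have "\<phi> (e a) = \<rho> a" for a
      using *(5)[of "fst a" "snd a"] by (simp add: \<rho>_def case_prod_unfold)
    ultimately have "\<rho> z = \<rho> w" by metis
    then show "z = w" using \<rho>\<rho> by metis
  qed
qed

lemma oriented_chart_plaque_continuous:
  assumes fol: "foliation M \<A>" and e: "e \<in> oriented_charts M \<A> Or"
  shows "continuous_map euclidean M (\<lambda>x. e (x, y))"
    "continuous_map euclidean (leaf_topology M \<A>) (\<lambda>x. e (x, y))"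
proof -
  obtain U \<phi> s s' where *: "(U, \<phi>) \<in> \<A>" "range e = U" "\<And>x y. \<phi> (e (x, y)) = (s * x, s' * y)"
    using oriented_chartsE[OF e] by metis
  have "continuous_on UNIV (\<lambda>x. (x, y))" by (intro continuous_intros)
  then have "continuous_map euclidean euclidean (\<lambda>x. (x, y))" by simp
  from continuous_map_compose[OF this oriented_chart_embedding(1)[OF fol e]]
  show "continuous_map euclidean M (\<lambda>x. e (x, y))" by (simp add: o_def)
  then show "continuous_map euclidean (leaf_topology M \<A>) (\<lambda>x. e (x, y))"
    by (rule continuous_map_leaf_topology[OF fol *(1), where y = "s' * y"]) (use * in auto)
qed

lemma saturated_leaf:
  assumes fol: "foliation M \<A>" and L: "L \<in> leaves M \<A>"
  shows "saturated (oriented_charts M \<A> Or) L"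
  unfolding saturated_def
  using leaves_contain_curve[OF L oriented_chart_plaque_continuous(2)[OF fol]] by blast

lemma oriented_charts_cover:
  assumes or: "oriented_foliation M \<A> Or" and p: "p \<in> topspace M"
  obtains e where "e \<in> oriented_charts M \<A> Or" "p \<in> range e"
proof -
  have fol: "foliation M \<A>" using or by (simp add: oriented_foliation_def)
  obtain U \<phi> where U: "(U, \<phi>) \<in> \<A>" "p \<in> U" using foliation_cover[OF fol p] by blast
  obtain s where s: "s \<in> {1, - 1}" "\<And>q. q \<in> U \<Longrightarrow> direction_in_chart_at M \<A> Or \<phi> s q"
    using direction_constant[OF or U(1)] by metis
  obtain \<psi> where \<psi>: "\<And>z. \<psi> z \<in> U" "\<And>z. \<phi> (\<psi> z) = z" "\<And>q. q \<in> U \<Longrightarrow> \<psi> (\<phi> q) = q"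
    using plane_chart_inverse[OF foliation_plane_chart[OF fol U(1)]] by metis
  define e where "e = (\<lambda>(x, y). \<psi> (s * x, y))"
  have ss: "s * (s * x) = x" for x using s(1) by auto
  have r: "q \<in> range e" if "q \<in> U" for q
  proof
    show "q = e (s * fst (\<phi> q), snd (\<phi> q))" using \<psi>(3)[OF that] by (simp add: e_def ss)
  qed simp
  have "range e = U" using r \<psi>(1) by (auto simp: e_def)
  moreover have "\<phi> (e (x, y)) = (s * x, 1 * y)" for x y by (simp add: e_def \<psi>)
  ultimately have "e \<in> oriented_charts M \<A> Or"
    unfolding oriented_charts_def using U(1) s by blast
  then show thesis using that r[OF U(2)] by blast
qed

text \<open>Within \<open>M\<close>, saturated sets are unions of plaques and so open in the leaf
  topology, and complements of saturated sets are saturated. A leaf is connected in this topology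
  and cannot be split by such a pair.\<close>

lemma indecomposable_leaf:
  assumes or: "oriented_foliation M \<A> Or" and L: "L \<in> leaves M \<A>"
  shows "indecomposable (oriented_charts M \<A> Or) L"
  unfolding indecomposable_def
proof (intro allI impI)
  have fol: "foliation M \<A>" using or by (simp add: oriented_foliation_def)
  let ?T = "leaf_topology M \<A>" and ?E = "oriented_charts M \<A> Or"
  fix S assume S: "saturated ?E S \<and> S \<inter> L \<noteq> {}"
  have sat_open: "openin ?T (R \<inter> topspace M)" if R: "saturated ?E R" for R
  proof (subst openin_subopen, intro ballI)
    fix p assume p: "p \<in> R \<inter> topspace M"
    then obtain e where e: "e \<in> ?E" "p \<in> range e"
      using oriented_charts_cover[OF or] by blast
    then obtain x y where xy: "p = e (x, y)" by auto
    obtain U \<phi> s s' where *: "(U, \<phi>) \<in> \<A>" "s * s = 1" "s' * s' = 1" "range e = U"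
        "\<And>x y. \<phi> (e (x, y)) = (s * x, s' * y)"
      using oriented_chartsE[OF e(1)] by metis
    have P: "{q \<in> U. snd (\<phi> q) = s' * y} \<inter> topspace M \<subseteq> R \<inter> topspace M"
    proof
      fix q assume q: "q \<in> {q \<in> U. snd (\<phi> q) = s' * y} \<inter> topspace M"
      then obtain x' y' where q': "q = e (x', y')" using *(4) by auto
      then have "s' * y' = s' * y" using q *(5) by simp
      then have "y' = y" using *(3) by (metis mult_cancel_left mult_zero_left zero_neq_one)
      then show "q \<in> R \<inter> topspace M"
        using q q' p xy R e(1) unfolding saturated_def by blast
    qed
    have "openin ?T ({q \<in> U. snd (\<phi> q) = s' * y} \<inter> topspace M)"
      by (rule openin_leaf_topology_plaque) (use *(1) in \<open>auto simp: plaques_def\<close>)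
    moreover have "p \<in> {q \<in> U. snd (\<phi> q) = s' * y} \<inter> topspace M"
      using p xy *(4,5) by auto
    ultimately show "\<exists>T. openin ?T T \<and> p \<in> T \<and> T \<subseteq> R \<inter> topspace M"
      using P by blast
  qed
  have "saturated ?E (- S)" using S unfolding saturated_def by blast
  then have "openin ?T (S \<inter> topspace M)" "openin ?T (- S \<inter> topspace M)"
    using sat_open S by blast+
  moreover have "connectedin ?T L"
    using L by (simp add: leaves_def path_connectedin_path_components_of path_connectedin_imp_connectedin)
  moreover have "L \<subseteq> topspace M"
    using connectedin_subset_topspace[OF \<open>connectedin ?T L\<close>] topspace_leaf_topology[OF fol] by blast
  ultimately show "L \<subseteq> S"
    using connectedinD[of ?T L "S \<inter> topspace M" "- S \<inter> topspace M"] S by blast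
qed

text \<open>The heights agree by the foliation condition. The coordinate \<open>\<xi>\<close>
  increases because both charts follow the orientation of the leaf: an orientation chart
  \<open>h\<close> at the common point mediates between them.\<close>

lemma oriented_charts_transition:
  assumes or: "oriented_foliation M \<A> Or"
    and e: "e \<in> oriented_charts M \<A> Or" and e': "e' \<in> oriented_charts M \<A> Or" and eq: "e (x, y) = e' (x', y')"
  shows "\<exists>\<delta>>0. \<exists>\<xi>. continuous_on (ball x' \<delta>) \<xi> \<and> strict_mono_on (ball x' \<delta>) \<xi> \<and>
        (\<forall>r\<in>ball x' \<delta>. e' (r, y') = e (\<xi> r, y))"
proof -
  have fol: "foliation M \<A>" using or by (simp add: oriented_foliation_def)
  obtain U \<phi> s s' where U: "(U, \<phi>) \<in> \<A>" "s * s = 1" "s' * s' = 1"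
     "\<And>q. q \<in> U \<Longrightarrow> direction_in_chart_at M \<A> Or \<phi> s q" "range e = U"
     "\<And>x y. \<phi> (e (x, y)) = (s * x, s' * y)"
    using oriented_chartsE[OF e] by metis
  obtain V \<psi> t t' where V: "(V, \<psi>) \<in> \<A>" "t * t = 1" "t' * t' = 1"
     "\<And>q. q \<in> V \<Longrightarrow> direction_in_chart_at M \<A> Or \<psi> t q" "range e' = V"
     "\<And>x y. \<psi> (e' (x, y)) = (t * x, t' * y)"
    using oriented_chartsE[OF e'] by metis
  obtain \<theta> where \<theta>: "\<And>q. q \<in> U \<Longrightarrow> \<theta> (\<phi> q) = q"
    using plane_chart_inverse[OF foliation_plane_chart[OF fol U(1)]] by metis
  have pc: "openin M U" "continuous_map (subtopology M U) euclidean \<phi>"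
    using foliation_plane_chart[OF fol U(1)] homeomorphic_imp_continuous_map
    by (auto simp: plane_chart_def)
  define c where "c r = e' (r, y')" for r
  define p where "p = e (x, y)"
  have p: "p \<in> U" "p \<in> V" "p = c x'"
    unfolding p_def c_def U(5)[symmetric] V(5)[symmetric] using eq by (auto, metis rangeI)
  obtain W where W: "openin M W" "p \<in> W" "W \<subseteq> V \<inter> U"
      "\<And>q. q \<in> W \<Longrightarrow> snd (\<psi> q) = snd (\<psi> p) \<Longrightarrow> snd (\<phi> q) = snd (\<phi> p)"
    using foliation_transition[OF fol V(1) U(1) p(2,1)] by metis
  have "p \<in> topspace M" using p(1) pc(1) openin_subset by blast
  then obtain L I h where L: "L \<in> leaves M \<A>" "p \<in> L" "(I, h) \<in> Or L" "p \<in> I" "inj_on h I"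
      "openin (subtopology (leaf_topology M \<A>) L) I"
    using orientation_chart_at[OF or] by metis
  let ?T = "subtopology (leaf_topology M \<A>) L"
  obtain W1 where W1: "openin ?T W1" "p \<in> W1" "\<And>x y. x \<in> W1 \<Longrightarrow> y \<in> W1 \<Longrightarrow> h x < h y \<Longrightarrow> s * fst (\<phi> x) < s * fst (\<phi> y)"
    using direction_in_chart_atD[OF U(4)[OF p(1)] L(1,3,4)] by metis
  obtain W2 where W2: "openin ?T W2" "p \<in> W2" "\<And>x y. x \<in> W2 \<Longrightarrow> y \<in> W2 \<Longrightarrow> h x < h y \<Longrightarrow> t * fst (\<psi> x) < t * fst (\<psi> y)"
    using direction_in_chart_atD[OF V(4)[OF p(2)] L(1,3,4)] by metis
  have cM: "continuous_map euclidean M c" and cT: "continuous_map euclidean (leaf_topology M \<A>) c"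
    using oriented_chart_plaque_continuous[OF fol e'] by (simp_all add: c_def[abs_def])
  have "range c \<subseteq> L" using leaves_contain_curve[OF L(1) cT, of x'] p(3) L(2) by simp
  then have cL: "continuous_map euclidean ?T c"
    using cT by (auto simp: continuous_map_in_subtopology)
  have "open (c -` W)"
    by (rule open_vimage_continuous_map[OF cM W(1)])
  moreover have "openin ?T (W1 \<inter> W2 \<inter> I)" using W1 W2 L by blast
  then have "open (c -` (W1 \<inter> W2 \<inter> I))"
    by (rule open_vimage_continuous_map[OF cL])
  ultimately have "open (c -` W \<inter> c -` (W1 \<inter> W2 \<inter> I))" by (rule open_Int)
  moreover have "x' \<in> c -` W \<inter> c -` (W1 \<inter> W2 \<inter> I)" using W W1 W2 L p(3) by simp
  ultimately obtain \<delta> where \<delta>: "\<delta> > 0" "ball x' \<delta> \<subseteq> c -` W \<inter> c -` (W1 \<inter> W2 \<inter> I)"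
    by (meson open_contains_ball)
  define \<xi> where "\<xi> r = s * fst (\<phi> (c r))" for r
  have inU: "c r \<in> U" if "r \<in> ball x' \<delta>" for r
    using that \<delta>(2) W(3) by blast
  have "continuous_map (top_of_set (ball x' \<delta>)) (subtopology M U) c"
    using inU continuous_map_from_subtopology[OF cM] by (auto simp: continuous_map_in_subtopology)
  from continuous_map_compose[OF this pc(2)] have "continuous_on (ball x' \<delta>) (\<lambda>r. \<phi> (c r))"
    by (simp add: o_def)
  then have "continuous_on (ball x' \<delta>) \<xi>"
    unfolding \<xi>_def by (intro continuous_intros)
  moreover have "strict_mono_on (ball x' \<delta>) \<xi>"
  proof (rule strict_mono_onI)
    fix r1 r2 assume r: "r1 \<in> ball x' \<delta>" "r2 \<in> ball x' \<delta>" "r1 < r2"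
    then have i: "c r1 \<in> W1" "c r1 \<in> W2" "c r1 \<in> I" "c r2 \<in> W1" "c r2 \<in> W2" "c r2 \<in> I"
      using \<delta>(2) by auto
    have f: "t * fst (\<psi> (c r)) = r" for r
      using V(2,6) by (simp add: c_def flip: mult.assoc)
    \<comment> \<open>\<open>same_direction_at\<close> leads from \<open>h\<close> to a chart
      coordinate. The way back uses injectivity of \<open>h\<close>: if the \<open>h\<close>-values
      were in the opposite order, so would be the parameters.\<close>
    have "c r1 \<noteq> c r2" using f[of r1] f[of r2] r(3) by auto
    then have "h (c r1) \<noteq> h (c r2)" using inj_onD[OF L(5)] i by blast
    moreover have "\<not> h (c r2) < h (c r1)" using W2(3) i f[of r1] f[of r2] r(3) by fastforce
    ultimately show "\<xi> r1 < \<xi> r2" using W1(3) i by (simp add: \<xi>_def)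
  qed
  moreover have "e' (r, y') = e (\<xi> r, y)" if r: "r \<in> ball x' \<delta>" for r
  proof -
    have "snd (\<psi> (c r)) = snd (\<psi> p)" using V(6) p(3) by (simp add: c_def)
    then have "snd (\<phi> (c r)) = s' * y"
      using W(4)[of "c r"] \<delta>(2) r U(6) by (auto simp: p_def)
    then have "\<phi> (c r) = \<phi> (e (\<xi> r, y))"
      using U(2,6) by (simp add: \<xi>_def prod_eq_iff flip: mult.assoc)
    then have "c r = e (\<xi> r, y)" using \<theta> inU[OF r] U(5) by (metis rangeI)
    then show ?thesis by (simp add: c_def)
  qed
  ultimately show ?thesis using \<delta>(1) by blast
qed

lemma directed_atlas_oriented_charts:
  assumes M: "surface M" and or: "oriented_foliation M \<A> Or"
  shows "directed_atlas M (oriented_charts M \<A> Or)"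
proof
  have fol: "foliation M \<A>" using or by (simp add: oriented_foliation_def)
  show "connected_space M" "Hausdorff_space M" using M by (auto simp: surface_def)
  fix e assume e: "e \<in> oriented_charts M \<A> Or"
  show "continuous_map euclidean M e" "open_map euclidean M e" "inj e"
    by (fact oriented_chart_embedding[OF fol e])+
  obtain U \<phi> s s' where *: "(U, \<phi>) \<in> \<A>" "s \<in> {1, - 1}" "s' \<in> {1, - 1}"
     "\<forall>q\<in>U. direction_in_chart_at M \<A> Or \<phi> s q" "range e = U" "\<forall>x y. \<phi> (e (x, y)) = (s * x, s' * y)"
    using e unfolding oriented_charts_def by blast
  have "e z \<in> range (\<lambda>(x, y). e (x, - y))" for z
    by (rule image_eqI[of _ _ "(fst z, - snd z)"]) auto
  then have "range (\<lambda>(x, y). e (x, - y)) = U"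
    unfolding *(5)[symmetric] by auto
  moreover have "- s' \<in> {1, - 1}" using *(3) by auto
  moreover have "\<forall>x y. \<phi> ((\<lambda>(x, y). e (x, - y)) (x, y)) = (s * x, - s' * y)" using *(6) by simp
  ultimately show "(\<lambda>(x, y). e (x, - y)) \<in> oriented_charts M \<A> Or"
    unfolding oriented_charts_def using *(1,2,4) by blast
  show "\<exists>\<delta>>0. \<exists>\<xi>. continuous_on (ball x' \<delta>) \<xi> \<and> strict_mono_on (ball x' \<delta>) \<xi> \<and>
        (\<forall>s\<in>ball x' \<delta>. e' (s, y') = e (\<xi> s, y))"
    if "e' \<in> oriented_charts M \<A> Or" "e (x, y) = e' (x', y')" for e' x y x' y'
    by (rule oriented_charts_transition[OF or e that])
next
  fix p assume "p \<in> topspace M"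
  then show "\<exists>e\<in>oriented_charts M \<A> Or. p \<in> range e"
    using oriented_charts_cover[OF or] by metis
qed

lemma interior_of_closure_of_finite_Union:
  assumes "finite \<L>" "\<And>L. L \<in> \<L> \<Longrightarrow> M interior_of (M closure_of L) = {}"
  shows "M interior_of (M closure_of \<Union>\<L>) = {}"
  using assms
  by (induction \<L>) (auto simp: closure_of_Un interior_of_union_eq_empty)

theorem lemma6p4:
  fixes M :: "'a topology"
    and \<A> :: "('a set \<times> ('a \<Rightarrow> real \<times> real)) set"
    and Or :: "'a set \<Rightarrow> ('a set \<times> ('a \<Rightarrow> real)) set"
  assumes "surface M"
    and "dichotomic M"
    and "oriented_foliation M \<A> Or"
  shows "(\<forall>L\<in>leaves M \<A>. \<not> dense_subset M L) \<and>
         (\<forall>\<L>. finite \<L> \<and> \<L> \<subseteq> leaves M \<A> \<longrightarrow> \<not> dense_subset M (\<Union>\<L>))"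
proof -
  have fol: "foliation M \<A>" using assms(3) by (simp add: oriented_foliation_def)
  interpret directed_atlas M "oriented_charts M \<A> Or"
    using assms(1,3) by (rule directed_atlas_oriented_charts)
  have "M interior_of (M closure_of L) = {}" if "L \<in> leaves M \<A>" for L
    using leaf_nowhere_dense[OF assms(2)] saturated_leaf[OF fol that] indecomposable_leaf[OF assms(3) that] .
  then have "M interior_of (M closure_of \<Union>\<L>) = {}" if "finite \<L>" "\<L> \<subseteq> leaves M \<A>" for \<L>
    using interior_of_closure_of_finite_Union that by (metis subsetD)
  \<comment> \<open>The closure of a dense set has all of \<open>M\<close> as its interior, and this
    is not empty.\<close>
  moreover have "topspace M \<noteq> {}" using assms(1) by (simp add: surface_def)
  ultimately have fin: "\<not> dense_subset M (\<Union>\<L>)" if "finite \<L>" "\<L> \<subseteq> leaves M \<A>" for \<L>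
    using that unfolding dense_subset_def by (metis interior_of_topspace)
  have "\<not> dense_subset M L" if "L \<in> leaves M \<A>" for L
    using fin[of "{L}"] that by simp
  with fin show ?thesis by blast
qed

end
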